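(* Assume the setting described in the context, and let $C_{\mathrm{PI}}<\infty$ be any constant such that, for every smooth $\varphi:M\to\mathbb R$, $$\int_M\left|\varphi-\int_M\varphi\,d\pi_M\right|^2d\pi_M\le C_{\mathrm{PI}}\int_M\|\nabla_M\varphi\|^2\,d\pi_M .$$ If $\mu=h\pi_M$ is a probability measure, $h\in L^2(\pi_M)$, and $h\ge b>0$ almost everywhere for a constant $b$, then $$W_2(\mu,\pi_M)\le\sqrt{\frac{C_{\mathrm{PI}}}{\min\{1,b\}}}\,\|h-1\|_{L^2(\pi_M)} .$$ Here $W_2$ uses the ambient Euclidean cost.
   Context: $1\le d<D$ are integers. The reach $\mathrm{Reach}(M)$ is the largest $\tau\ge0$ such that every point at distance less than $\tau$ from $M$ has a unique nearest point on $M$. $M\subset\mathbb R^D$ is a compact, connected, $d$-dimensional $C^2$ embedded submanifold without boundary with $\mathrm{Reach}(M)\ge\tau_0>0$, equipped with the induced Riemannian metric; $\mathrm{Vol}_M$ is its Riemannian volume and $\nabla_M$ its Riemannian gradient. There are $z_0\in\mathbb R^D$, $R_0>0$ with $M\subseteq\overline B(z_0,R_0)$; fix $0<2r<\tau_0$ and set $K:=\overline B(z_0,R_0+3r)$. $g$ is $C^2$ on a neighborhood of $K$, with $\sup_K\|\nabla g\|$, $\sup_K\|\nabla^2g\|_{\mathrm{op}}$ and $\sup_Kg-\inf_Kg$ finite. The Gibbs law is $\pi_M(dy):=Z_M^{-1}e^{-g(y)}\mathrm{Vol}_M(dy)$ with $Z_M:=\int_Me^{-g}\,d\mathrm{Vol}_M$.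 $W_2(\mu,\nu):=\left(\inf_\gamma\int\|x-y\|^2\gamma(dx,dy)\right)^{1/2}$, the infimum over couplings of $\mu,\nu$ and $\|\cdot\|$ the Euclidean norm of $\mathbb R^D$. *)

theory Defs
  imports "HOL-Probability.Probability"
begin

(* Meaningful for open S; on a finite-dimensional domain, continuity of all iterated
   directional derivatives is the usual C^k condition. *)
primrec Ck_on :: "nat \<Rightarrow> ('a::real_normed_vector \<Rightarrow> 'b::real_normed_vector) \<Rightarrow> 'a set \<Rightarrow> bool" where
  "Ck_on 0 f S = continuous_on S f"
| "Ck_on (Suc k) f S =
     ((\<forall>x\<in>S. f differentiable (at x)) \<and>
      (\<forall>v. Ck_on k (\<lambda>x. frechet_derivative f (at x) v) S))"

definition gradient :: "(real^'n \<Rightarrow> real) \<Rightarrow> real^'n \<Rightarrow> real^'n" where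
  "gradient f x = (\<chi> i. frechet_derivative f (at x) (axis i 1))"

definition hessian :: "(real^'n \<Rightarrow> real) \<Rightarrow> real^'n \<Rightarrow> real^'n \<Rightarrow> real^'n" where
  "hessian f x = frechet_derivative (gradient f) (at x)"

text \<open>Embedded \<open>C\<^sup>2\<close> submanifolds of dimension \<open>CARD('d)\<close> without boundary: each point lies in a
  relatively open piece that is the homeomorphic image of an open subset of \<open>real^'d\<close> under a
  \<open>C\<^sup>2\<close> immersion.\<close>

definition local_param ::
    "(real^'n) set \<Rightarrow> (real^'d) set \<Rightarrow> (real^'d \<Rightarrow> real^'n) \<Rightarrow> bool" where
  "local_param M V \<psi> \<longleftrightarrow>
     open V \<and> Ck_on 2 \<psi> V \<and>
     (\<forall>u\<in>V. inj (frechet_derivative \<psi> (at u))) \<and>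
     openin (top_of_set M) (\<psi> ` V) \<and>
     (\<exists>\<psi>'. homeomorphism V (\<psi> ` V) \<psi> \<psi>')"

definition C2_submanifold :: "'d::finite itself \<Rightarrow> (real^'n) set \<Rightarrow> bool" where
  "C2_submanifold _ M \<longleftrightarrow>
     (\<forall>p\<in>M. \<exists>(V :: (real^'d) set) \<psi>. local_param M V \<psi> \<and> p \<in> \<psi> ` V)"

(* Extended-real valued: the reach of, e.g., a nonempty closed convex set is infinite. *)
definition reach :: "'a::metric_space set \<Rightarrow> ereal" where
  "reach M = Sup {ereal \<tau> | \<tau>. 0 \<le> \<tau> \<and>
     (\<forall>x. infdist x M < \<tau> \<longrightarrow> (\<exists>!y. y \<in> M \<and> dist x y = infdist x M))}"

definition gram_density :: "(real^'d \<Rightarrow> real^'n) \<Rightarrow> real^'d \<Rightarrow> real" where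
  "gram_density \<psi> u =
     (let J = matrix (frechet_derivative \<psi> (at u)) in sqrt (det (transpose J ** J)))"

(* The volume of the induced metric is the unique Borel measure on M that in every local
   parametrization has density sqrt (det (g_ij)), where g_ij = D_i \<psi> \<bullet> D_j \<psi>. *)
definition riemannian_volume :: "'d::finite itself \<Rightarrow> (real^'n) set \<Rightarrow> (real^'n) measure \<Rightarrow> bool" where
  "riemannian_volume _ M vol \<longleftrightarrow>
     sets vol = sets (restrict_space borel M) \<and>
     (\<forall>(V :: (real^'d) set) \<psi> A.
        local_param M V \<psi> \<and> A \<in> sets vol \<and> A \<subseteq> \<psi> ` V \<longrightarrow>
        emeasure vol A =
          (\<integral>\<^sup>+ u. ennreal (gram_density \<psi> u) * indicator (V \<inter> \<psi> -` A) u \<partial>lborel))"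

definition C1_curve_in ::
    "(real^'n) set \<Rightarrow> real^'n \<Rightarrow> (real \<Rightarrow> real^'n) \<Rightarrow> real^'n \<Rightarrow> bool" where
  "C1_curve_in M p \<gamma> v \<longleftrightarrow>
     (\<exists>e>0. \<gamma> ` {-e<..<e} \<subseteq> M \<and> Ck_on 1 \<gamma> {-e<..<e}) \<and>
     \<gamma> 0 = p \<and> (\<gamma> has_vector_derivative v) (at 0)"

definition tangent_space :: "(real^'n) set \<Rightarrow> real^'n \<Rightarrow> (real^'n) set" where
  "tangent_space M p = {v. \<exists>\<gamma>. C1_curve_in M p \<gamma> v}"

(* The tangent vector representing the differential of f at p with respect to the induced metric;
   the metric on tangent spaces is the restriction of the ambient inner product. *)
definition riemannian_gradient ::
    "(real^'n) set \<Rightarrow> (real^'n \<Rightarrow> real) \<Rightarrow> real^'n \<Rightarrow> real^'n" where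
  "riemannian_gradient M f p =
     (THE w. w \<in> tangent_space M p \<and>
        (\<forall>\<gamma> v. C1_curve_in M p \<gamma> v \<longrightarrow> ((\<lambda>t. f (\<gamma> t)) has_real_derivative (w \<bullet> v)) (at 0)))"

(* Smoothness of a function on a subset of Euclidean space: local C^infinity extendability.
   Only the values of f on M matter. *)
definition smooth_on_submanifold :: "(real^'n) set \<Rightarrow> (real^'n \<Rightarrow> real) \<Rightarrow> bool" where
  "smooth_on_submanifold M f \<longleftrightarrow>
     (\<forall>p\<in>M. \<exists>U F. open U \<and> p \<in> U \<and> (\<forall>k. Ck_on k F U) \<and> (\<forall>x\<in>U \<inter> M. F x = f x))"

definition gibbs_measure :: "'a measure \<Rightarrow> ('a \<Rightarrow> real) \<Rightarrow> 'a measure" where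
  "gibbs_measure vol g =
     (let Z = (\<integral>y. exp (- g y) \<partial>vol) in density vol (\<lambda>y. ennreal (exp (- g y) / Z)))"

definition poincare_constant :: "(real^'n) set \<Rightarrow> (real^'n) measure \<Rightarrow> real \<Rightarrow> bool" where
  "poincare_constant M \<pi> C \<longleftrightarrow>
     (\<forall>\<phi>. smooth_on_submanifold M \<phi> \<longrightarrow>
        (\<integral>x. \<bar>\<phi> x - (\<integral>y. \<phi> y \<partial>\<pi>)\<bar>\<^sup>2 \<partial>\<pi>)
          \<le> C * (\<integral>x. (norm (riemannian_gradient M \<phi> x))\<^sup>2 \<partial>\<pi>))"

definition couplings :: "'a measure \<Rightarrow> 'b measure \<Rightarrow> ('a \<times> 'b) measure set" where
  "couplings \<mu> \<nu> =
     {\<gamma>. sets \<gamma> = sets (\<mu> \<Otimes>\<^sub>M \<nu>) \<and> distr \<gamma> \<mu> fst = \<mu> \<and> distr \<gamma> \<nu> snd = \<nu>}"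

definition transport_cost2 :: "'a::real_normed_vector measure \<Rightarrow> 'a measure \<Rightarrow> ennreal" where
  "transport_cost2 \<mu> \<nu> =
     (INF \<gamma>\<in>couplings \<mu> \<nu>. \<integral>\<^sup>+ z. ennreal ((norm (fst z - snd z))\<^sup>2) \<partial>\<gamma>)"

(* The case distinction is the square root on ennreal. *)
definition W2 :: "'a::real_normed_vector measure \<Rightarrow> 'a measure \<Rightarrow> ennreal" where
  "W2 \<mu> \<nu> =
     (if transport_cost2 \<mu> \<nu> = \<infinity> then \<infinity> else ennreal (sqrt (enn2real (transport_cost2 \<mu> \<nu>))))"

end

theory Submission
  imports Defs
begin

text \<open>
  The classical argument moves mass along the curve of densities \<open>1 + s (h - 1)\<close>, \<open>0 \<le> s \<le> 1\<close>, and
  bounds the kinetic energy by the Poincare inequality. It is carried out here on the dual side,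
  with explicit test functions that are smooth on all of the ambient space.

  For finitely many points \<open>y\<^sub>j\<close> with heights \<open>\<phi>\<^sub>j\<close>, let \<open>S\<^sub>t x\<close> be the soft minimum (log-sum-exp at
  temperature \<open>e\<close>) over \<open>j\<close> of \<open>\<phi>\<^sub>j + |x - y\<^sub>j|\<^sup>2 / (2 t)\<close>. Its spatial gradient is the mean of
  \<open>(x - y\<^sub>j) / t\<close> under the soft-min weights \<open>w\<^sub>j x\<close>, and its time derivative is minus one half of the
  mean of \<open>|x - y\<^sub>j|\<^sup>2 / t\<^sup>2\<close>. Jensen's inequality therefore gives the Hamilton--Jacobi inequality
  \<open>\<partial>\<^sub>t S + |\<nabla> S|\<^sup>2 / 2 \<le> 0\<close> at every point (\<open>hopf_lax_hamilton_jacobi\<close>).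

  Write \<open>\<beta> = min 1 b\<close> and \<open>H\<close> for the squared distance of \<open>h\<close> from 1 in \<open>L\<^sup>2\<close>. Along densities
  \<open>\<rho>\<^sub>t \<ge> \<beta>\<close> that go linearly from 1 at time \<open>d\<close> to \<open>h\<close> at time 1, the derivative of \<open>\<integral> S\<^sub>t \<rho>\<^sub>t d\<pi>\<close> is at most
  \<open>- \<beta> / 2 \<integral> |\<nabla> S\<^sub>t|\<^sup>2 d\<pi> + \<integral> S\<^sub>t (h - 1) d\<pi> / (1 - d)\<close>. The second term sees only the oscillation of
  \<open>S\<^sub>t\<close>, so the Poincare inequality and Young's inequality bound the sum by
  \<open>C H / (2 \<beta> (1 - d)\<^sup>2)\<close> (\<open>hopf_lax_integral_increase\<close>). If the \<open>y\<^sub>j\<close> lie within \<open>d\<close> of cells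
  of mass \<open>q\<^sub>j\<close> that partition \<open>M\<close>, then \<open>S\<^sub>d \<le> \<phi>\<^sub>j + d / 2\<close> on cell \<open>j\<close>, and hence
  \<open>\<integral> S\<^sub>1 d\<mu> - (\<Sum>j. q\<^sub>j \<phi>\<^sub>j) \<le> d / 2 + C H / (2 \<beta> (1 - d))\<close> for all heights \<open>\<phi>\<close>.

  The left-hand side is the dual functional of entropic optimal transport from \<open>\<mu>\<close> to the
  discretized \<open>\<pi>\<close>. It attains its maximum over \<open>\<phi>\<close>, and there stationarity says that
  \<open>\<integral> w\<^sub>j d\<mu> = q\<^sub>j\<close> (\<open>entropic_optimality\<close>). Sending \<open>x\<close> to cell \<open>j\<close> with probability \<open>w\<^sub>j x\<close>, and to a
  \<open>\<pi>\<close>-random point inside that cell, is then a coupling of \<open>\<mu>\<close> and \<open>\<pi>\<close>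
  (\<open>transport_cost2_le_semidiscrete\<close>). Its cost exceeds twice the dual value only by terms that vanish with
  \<open>e\<close> and \<open>d\<close> (\<open>hopf_lax_weighted_cost\<close>), which leaves \<open>W\<^sub>2\<^sup>2 \<le> C H / \<beta>\<close>.

  The manifold enters only through \<open>norm_riemannian_gradient_le\<close>: the Riemannian gradient of the restriction
  to \<open>M\<close> is the tangential part of the ambient gradient, so its norm is at most that of the ambient gradient, and
  the Poincare inequality on \<open>M\<close> may be used with ambient gradients.
\<close>

section \<open>Smooth functions closed under directional derivatives\<close>

text \<open>
  The generators are just enough to build log-sum-exp functions of quadratic polynomials. The class is
  closed under directional derivatives, so membership gives all orders of differentiability at once,
  with no calculus of higher derivatives.
\<close>

inductive elementary_smooth :: "('a::real_inner \<Rightarrow> real) \<Rightarrow> bool" where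
  const: "elementary_smooth (\<lambda>x. c)"
| inner: "elementary_smooth (\<lambda>x. x \<bullet> v)"
| inner_self: "elementary_smooth (\<lambda>x. x \<bullet> x)"
| add: "elementary_smooth f \<Longrightarrow> elementary_smooth g \<Longrightarrow> elementary_smooth (\<lambda>x. f x + g x)"
| mult: "elementary_smooth f \<Longrightarrow> elementary_smooth g \<Longrightarrow> elementary_smooth (\<lambda>x. f x * g x)"
| exp: "elementary_smooth f \<Longrightarrow> elementary_smooth (\<lambda>x. exp (f x))"
| ln: "elementary_smooth f \<Longrightarrow> (\<And>x. 0 < f x) \<Longrightarrow> elementary_smooth (\<lambda>x. ln (f x))"

lemma elementary_smooth_sum:
  assumes "finite J" "\<And>j. j \<in> J \<Longrightarrow> elementary_smooth (f j)"
  shows "elementary_smooth (\<lambda>x. \<Sum>j\<in>J. f j x)"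
  using assms by (induction J rule: finite_induct) (auto intro: elementary_smooth.intros)

lemma elementary_smooth_derivative:
  assumes "elementary_smooth f"
  shows "\<exists>f'. (\<forall>x. (f has_derivative f' x) (at x)) \<and> (\<forall>v. elementary_smooth (\<lambda>x. f' x v))"
  using assms
proof induction
  case (const c)
  show ?case
    by (intro exI[of _ "\<lambda>x v. 0"]) (auto intro: elementary_smooth.const)
next
  case (inner v)
  show ?case
    by (intro exI[of _ "\<lambda>x u. u \<bullet> v"])
      (auto intro: elementary_smooth.const intro!: derivative_eq_intros)
next
  case inner_self
  have "elementary_smooth (\<lambda>x. 2 * (x \<bullet> v))" for v :: 'a
    by (intro elementary_smooth.intros)
  then show ?case
    by (intro exI[of _ "\<lambda>x v. 2 * (x \<bullet> v)"])
      (auto intro!: derivative_eq_intros simp: inner_commute)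
next
  case (add f g)
  then obtain f' g' where "\<And>x. (f has_derivative f' x) (at x)" "\<And>x. (g has_derivative g' x) (at x)"
    "\<And>v. elementary_smooth (\<lambda>x. f' x v)" "\<And>v. elementary_smooth (\<lambda>x. g' x v)"
    by metis
  then show ?case
    by (intro exI[of _ "\<lambda>x v. f' x v + g' x v"] conjI allI has_derivative_add
        elementary_smooth.add) auto
next
  case (mult f g)
  then obtain f' g' where "\<And>x. (f has_derivative f' x) (at x)" "\<And>x. (g has_derivative g' x) (at x)"
    "\<And>v. elementary_smooth (\<lambda>x. f' x v)" "\<And>v. elementary_smooth (\<lambda>x. g' x v)"
    by metis
  with mult.hyps show ?case
    by (intro exI[of _ "\<lambda>x v. f x * g' x v + f' x v * g x"] conjI allI has_derivative_mult
        elementary_smooth.add elementary_smooth.mult)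
next
  case (exp f)
  then obtain f' where "\<And>x. (f has_derivative f' x) (at x)" "\<And>v. elementary_smooth (\<lambda>x. f' x v)"
    by metis
  with exp.hyps show ?case
    by (intro exI[of _ "\<lambda>x v. f' x v * exp (f x)"] conjI allI)
      (auto intro: elementary_smooth.mult elementary_smooth.exp intro!: derivative_eq_intros)
next
  case (ln f)
  then obtain f' where f': "\<And>x. (f has_derivative f' x) (at x)" "\<And>v. elementary_smooth (\<lambda>x. f' x v)"
    by metis
  \<comment> \<open>The derivative of \<open>ln\<close> needs \<open>inverse (f x)\<close>, which the class contains as \<open>exp (- ln (f x))\<close>.\<close>
  have "elementary_smooth (\<lambda>x. f' x v * exp (- 1 * ln (f x)))" for v
    by (intro elementary_smooth.intros f' ln.hyps)
  moreover have "exp (- 1 * ln (f x)) = inverse (f x)" for x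
    using ln.hyps(2)[of x] by (simp add: exp_minus)
  ultimately have "elementary_smooth (\<lambda>x. f' x v * inverse (f x))" for v
    by simp
  with f' ln.hyps(2) show ?case
    by (intro exI[of _ "\<lambda>x v. f' x v * inverse (f x)"])
      (auto intro!: derivative_eq_intros)
qed

lemma elementary_smooth_imp_Ck_on:
  assumes "elementary_smooth f"
  shows "Ck_on k f S"
  using assms
proof (induction k arbitrary: f)
  case 0
  then obtain f' where "\<And>x. (f has_derivative f' x) (at x)"
    using elementary_smooth_derivative by blast
  then show ?case
    by (auto intro!: continuous_at_imp_continuous_on has_derivative_continuous)
next
  case (Suc k)
  then obtain f' where f': "\<And>x. (f has_derivative f' x) (at x)" "\<And>v. elementary_smooth (\<lambda>x. f' x v)"
    using elementary_smooth_derivative by blast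
  then have "frechet_derivative f (at x) = f' x" for x
    by (metis frechet_derivative_at)
  with f' Suc.IH show ?case
    by (auto simp: differentiable_def)
qed

lemma continuous_on_elementary_smooth:
  "elementary_smooth f \<Longrightarrow> continuous_on S f"
  using elementary_smooth_imp_Ck_on[of f 0 S] by simp

section \<open>The soft minimum\<close>

definition softmin :: "real \<Rightarrow> 'i set \<Rightarrow> ('i \<Rightarrow> real) \<Rightarrow> real" where
  "softmin e J a = - e * ln (\<Sum>j\<in>J. exp (- a j / e))"

text \<open>
  The Gibbs weights at temperature \<open>e\<close>; they are the partial derivatives of \<open>softmin\<close>.
\<close>

definition softmin_weight :: "real \<Rightarrow> 'i set \<Rightarrow> ('i \<Rightarrow> real) \<Rightarrow> 'i \<Rightarrow> real" where
  "softmin_weight e J a j = exp (- a j / e) / (\<Sum>k\<in>J. exp (- a k / e))"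

context
  fixes J :: "'i set" and e :: real
  assumes J: "finite J" "J \<noteq> {}" and e: "0 < e"
begin

lemma softmin_sum_pos: "0 < (\<Sum>j\<in>J. exp (- a j / e))"
  by (intro sum_pos J) simp

lemma softmin_weight_pos: "0 < softmin_weight e J a j"
  unfolding softmin_weight_def using softmin_sum_pos by simp

lemma sum_softmin_weight: "(\<Sum>j\<in>J. softmin_weight e J a j) = 1"
  unfolding softmin_weight_def sum_divide_distrib[symmetric]
  using softmin_sum_pos[of a] by simp

lemma softmin_weight_le_1: "j \<in> J \<Longrightarrow> softmin_weight e J a j \<le> 1"
  using member_le_sum[of j J "softmin_weight e J a"] J(1) softmin_weight_pos
  by (simp add: sum_softmin_weight less_imp_le)

text \<open>
  This identity carries the entropic duality: it reads each cost \<open>a j\<close> off from the value of the soft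
  minimum and the logarithm of a weight.
\<close>

lemma ln_softmin_weight:
  "e * ln (softmin_weight e J a j) = softmin e J a - a j"
  unfolding softmin_weight_def softmin_def
  using softmin_sum_pos[of a] e by (simp add: ln_div field_simps)

lemma softmin_le:
  assumes "j \<in> J"
  shows "softmin e J a \<le> a j"
proof -
  have "e * ln (softmin_weight e J a j) \<le> 0"
    using softmin_weight_le_1[OF assms, of a] softmin_weight_pos[of a j] e
    by (simp add: mult_le_0_iff)
  then show ?thesis
    by (simp add: ln_softmin_weight)
qed

lemma softmin_add_const: "softmin e J (\<lambda>j. a j + c) = softmin e J a + c"
proof -
  have "(\<Sum>j\<in>J. exp (- (a j + c) / e)) = exp (- c / e) * (\<Sum>j\<in>J. exp (- a j / e))"
    by (simp add: sum_distrib_left diff_divide_distrib add.commute flip: exp_add)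
  then show ?thesis
    unfolding softmin_def using softmin_sum_pos[of a] e
    by (simp add: ln_mult_pos field_simps)
qed

lemma softmin_mono:
  assumes "\<And>j. j \<in> J \<Longrightarrow> a j \<le> a' j"
  shows "softmin e J a \<le> softmin e J a'"
proof -
  have "(\<Sum>j\<in>J. exp (- a' j / e)) \<le> (\<Sum>j\<in>J. exp (- a j / e))"
    using assms e by (intro sum_mono) (simp add: divide_le_cancel)
  then show ?thesis
    unfolding softmin_def using softmin_sum_pos e by simp
qed

lemma softmin_lipschitz:
  "\<bar>softmin e J a - softmin e J a'\<bar> \<le> (\<Sum>j\<in>J. \<bar>a j - a' j\<bar>)"
proof -
  have *: "softmin e J a \<le> softmin e J a' + (\<Sum>j\<in>J. \<bar>a j - a' j\<bar>)" for a a' :: "'i \<Rightarrow> real"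
  proof -
    have "a j \<le> a' j + (\<Sum>j\<in>J. \<bar>a j - a' j\<bar>)" if "j \<in> J" for j
      using member_le_sum[OF that, of "\<lambda>j. \<bar>a j - a' j\<bar>"] J(1) by fastforce
    then have "softmin e J a \<le> softmin e J (\<lambda>j. a' j + (\<Sum>j\<in>J. \<bar>a j - a' j\<bar>))"
      by (rule softmin_mono)
    then show ?thesis by (simp only: softmin_add_const)
  qed
  from *[of a a'] *[of a' a] show ?thesis
    by (simp add: abs_le_iff abs_minus_commute)
qed

text \<open>
  By \<open>ln_softmin_weight\<close>, the mean of \<open>a\<close> under the weights exceeds the soft minimum by \<open>e\<close> times the
  entropy of the weights. Bounding each \<open>- w ln w\<close> by 1 is crude, but the error disappears
  as \<open>e\<close> tends to 0 with \<open>J\<close> fixed.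
\<close>

lemma sum_softmin_weight_le:
  "(\<Sum>j\<in>J. softmin_weight e J a j * a j) \<le> softmin e J a + e * real (card J)"
proof -
  have "softmin_weight e J a j * a j \<le> softmin_weight e J a j * softmin e J a + e" for j
  proof -
    define w where "w = softmin_weight e J a j"
    have w: "0 < w" using softmin_weight_pos w_def by simp
    have "ln (inverse w) \<le> inverse w - 1"
      using w by (intro ln_le_minus_one) simp
    then have "- ln w \<le> inverse w - 1"
      using w by (simp add: ln_inverse)
    then have "w * - ln w \<le> w * (inverse w - 1)"
      using w by (intro mult_left_mono) auto
    also have "\<dots> \<le> 1"
      using w by (simp add: algebra_simps)
    finally have "e * (w * - ln w) \<le> e"
      using e mult_left_mono[of "w * - ln w" 1 e] by simp
    moreover have "a j = softmin e J a - e * ln w"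
      unfolding w_def by (simp add: ln_softmin_weight)
    then have "w * a j = w * (softmin e J a - e * ln w)"
      by simp
    then have "w * a j = w * softmin e J a + e * (w * - ln w)"
      by (simp only: right_diff_distrib) simp
    ultimately show ?thesis unfolding w_def by linarith
  qed
  then have "(\<Sum>j\<in>J. softmin_weight e J a j * a j)
      \<le> (\<Sum>j\<in>J. softmin_weight e J a j * softmin e J a + e)"
    by (rule sum_mono)
  also have "\<dots> = softmin e J a + e * real (card J)"
    by (simp add: sum.distrib sum_softmin_weight flip: sum_distrib_right)
  finally show ?thesis .
qed

lemma has_derivative_softmin:
  assumes "\<And>j. j \<in> J \<Longrightarrow> ((\<lambda>x. a x j) has_derivative a' j) (at x within S)"
  shows "((\<lambda>x. softmin e J (a x)) has_derivative
    (\<lambda>v. \<Sum>j\<in>J. softmin_weight e J (a x) j * a' j v)) (at x within S)"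
proof -
  let ?Z = "\<lambda>x. \<Sum>j\<in>J. exp (- a x j / e)"
  have Z: "0 < ?Z x" by (rule softmin_sum_pos)
  have "(?Z has_derivative (\<lambda>v. \<Sum>j\<in>J. exp (- a x j / e) * (- a' j v / e))) (at x within S)"
  proof (intro has_derivative_sum)
    fix j assume "j \<in> J"
    from assms[OF this] e show "((\<lambda>x. exp (- a x j / e)) has_derivative
        (\<lambda>v. exp (- a x j / e) * (- a' j v / e))) (at x within S)"
      by (auto intro!: derivative_eq_intros)
  qed
  then have "((\<lambda>x. - e * ln (?Z x)) has_derivative
    (\<lambda>v. - e * ((\<Sum>j\<in>J. exp (- a x j / e) * (- a' j v / e)) * inverse (?Z x)))) (at x within S)"
    by (intro has_derivative_mult_right has_derivative_ln Z)
  moreover have "- e * ((\<Sum>j\<in>J. exp (- a x j / e) * (- a' j v / e)) * inverse (?Z x)) =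
      (\<Sum>j\<in>J. softmin_weight e J (a x) j * a' j v)" for v
    using e by (simp add: sum_distrib_left sum_distrib_right softmin_weight_def sum_negf divide_inverse)
      (simp add: mult_ac flip: mult.assoc[of e])
  ultimately show ?thesis
    by (simp add: softmin_def)
qed

lemma has_real_derivative_softmin:
  assumes "\<And>j. j \<in> J \<Longrightarrow> ((\<lambda>t. a t j) has_real_derivative a' j) (at t within S)"
  shows "((\<lambda>t. softmin e J (a t)) has_real_derivative
    (\<Sum>j\<in>J. softmin_weight e J (a t) j * a' j)) (at t within S)"
proof -
  have "(\<lambda>v. \<Sum>j\<in>J. softmin_weight e J (a t) j * (a' j * v)) =
      (*) (\<Sum>j\<in>J. softmin_weight e J (a t) j * a' j)"
    by (simp add: fun_eq_iff sum_distrib_right mult.assoc)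
  with has_derivative_softmin[of a "\<lambda>j. (*) (a' j)" t S] assms show ?thesis
    by (simp add: has_field_derivative_def)
qed

lemma elementary_smooth_softmin:
  assumes "\<And>j. j \<in> J \<Longrightarrow> elementary_smooth (\<lambda>x. a x j)"
  shows "elementary_smooth (\<lambda>x. softmin e J (a x))"
proof -
  have "elementary_smooth (\<lambda>x. - e * ln (\<Sum>j\<in>J. exp ((- 1 / e) * a x j)))"
    using assms softmin_sum_pos
    by (intro elementary_smooth.intros elementary_smooth_sum J) auto
  then show ?thesis
    by (simp add: softmin_def)
qed

end

section \<open>The softened Hopf--Lax semigroup\<close>

text \<open>
  The Hopf--Lax semigroup at time \<open>t\<close>, with the infimum over \<open>j\<close> softened at temperature \<open>e\<close>, applied to
  the function that is \<open>\<phi> j\<close> at \<open>y j\<close> and infinite elsewhere.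
\<close>

definition hopf_lax :: "real \<Rightarrow> 'i set \<Rightarrow> ('i \<Rightarrow> 'a) \<Rightarrow> ('i \<Rightarrow> real) \<Rightarrow> real \<Rightarrow> 'a::real_inner \<Rightarrow> real" where
  "hopf_lax e J y \<phi> t x = softmin e J (\<lambda>j. \<phi> j + (norm (x - y j))\<^sup>2 / (2 * t))"

definition hopf_lax_weight ::
    "real \<Rightarrow> 'i set \<Rightarrow> ('i \<Rightarrow> 'a) \<Rightarrow> ('i \<Rightarrow> real) \<Rightarrow> real \<Rightarrow> 'a::real_inner \<Rightarrow> 'i \<Rightarrow> real" where
  "hopf_lax_weight e J y \<phi> t x = softmin_weight e J (\<lambda>j. \<phi> j + (norm (x - y j))\<^sup>2 / (2 * t))"

definition hopf_lax_gradient ::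
    "real \<Rightarrow> 'i set \<Rightarrow> ('i \<Rightarrow> 'a) \<Rightarrow> ('i \<Rightarrow> real) \<Rightarrow> real \<Rightarrow> 'a \<Rightarrow> 'a::real_inner" where
  "hopf_lax_gradient e J y \<phi> t x =
     (\<Sum>j\<in>J. hopf_lax_weight e J y \<phi> t x j *\<^sub>R ((x - y j) /\<^sub>R t))"

definition hopf_lax_time_derivative ::
    "real \<Rightarrow> 'i set \<Rightarrow> ('i \<Rightarrow> 'a) \<Rightarrow> ('i \<Rightarrow> real) \<Rightarrow> real \<Rightarrow> 'a::real_inner \<Rightarrow> real" where
  "hopf_lax_time_derivative e J y \<phi> t x =
     - (\<Sum>j\<in>J. hopf_lax_weight e J y \<phi> t x j * (norm (x - y j))\<^sup>2) / (2 * t\<^sup>2)"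

lemma norm_weighted_sum_power2_le:
  fixes u :: "'i \<Rightarrow> 'a::real_normed_vector"
  assumes w: "\<And>j. j \<in> J \<Longrightarrow> 0 \<le> w j" "(\<Sum>j\<in>J. w j) = 1"
  shows "(norm (\<Sum>j\<in>J. w j *\<^sub>R u j))\<^sup>2 \<le> (\<Sum>j\<in>J. w j * (norm (u j))\<^sup>2)"
proof -
  \<comment> \<open>The variance of \<open>norm (u j)\<close> under the weights \<open>w\<close> is nonnegative.\<close>
  define m where "m = (\<Sum>j\<in>J. w j * norm (u j))"
  have "norm (\<Sum>j\<in>J. w j *\<^sub>R u j) \<le> m"
    unfolding m_def using w(1) by (intro order.trans[OF norm_sum] sum_mono) simp
  moreover have "0 \<le> (\<Sum>j\<in>J. w j * (norm (u j) - m)\<^sup>2)"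
    using w(1) by (intro sum_nonneg) simp
  moreover have "(\<Sum>j\<in>J. w j * (norm (u j) - m)\<^sup>2) =
      (\<Sum>j\<in>J. w j * (norm (u j))\<^sup>2) - 2 * m * (\<Sum>j\<in>J. w j * norm (u j)) + m\<^sup>2 * (\<Sum>j\<in>J. w j)"
    by (simp add: sum_distrib_left sum_distrib_right power2_diff algebra_simps sum.distrib sum_subtractf)
  ultimately have "m\<^sup>2 \<le> (\<Sum>j\<in>J. w j * (norm (u j))\<^sup>2)"
    by (simp add: w(2) power2_eq_square flip: m_def)
  then show ?thesis
    using \<open>norm _ \<le> m\<close> power_mono[OF _ norm_ge_zero] order.trans by blast
qed

context
  fixes J :: "'i set" and e :: real and y :: "'i \<Rightarrow> 'a::real_inner" and \<phi> :: "'i \<Rightarrow> real"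
  assumes J: "finite J" "J \<noteq> {}" and e: "0 < e"
begin

lemma elementary_smooth_hopf_lax: "elementary_smooth (hopf_lax e J y \<phi> t)"
proof -
  have "elementary_smooth (\<lambda>x. \<phi> j + inverse (2 * t) * (x \<bullet> x + (- 2 * (x \<bullet> y j) + y j \<bullet> y j)))" for j
    by (rule elementary_smooth.const elementary_smooth.inner_self elementary_smooth.inner
        elementary_smooth.add elementary_smooth.mult)+
  moreover have "x \<bullet> x + (- 2 * (x \<bullet> y j) + y j \<bullet> y j) = (norm (x - y j))\<^sup>2" for j x
    unfolding power2_norm_eq_inner inner_diff_left inner_diff_right inner_commute[of "y j" x] by linarith
  then have "\<phi> j + inverse (2 * t) * (x \<bullet> x + (- 2 * (x \<bullet> y j) + y j \<bullet> y j)) =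
      \<phi> j + (norm (x - y j))\<^sup>2 / (2 * t)" for j x
    by (simp only: divide_inverse mult.commute)
  ultimately show ?thesis
    unfolding hopf_lax_def by (intro elementary_smooth_softmin J e) (simp only:)
qed

lemma has_derivative_hopf_lax:
  "(hopf_lax e J y \<phi> t has_derivative (\<lambda>v. hopf_lax_gradient e J y \<phi> t x \<bullet> v)) (at x)"
proof -
  have "((\<lambda>x. \<phi> j + (norm (x - y j))\<^sup>2 / (2 * t)) has_derivative
      (\<lambda>v. ((x - y j) /\<^sub>R t) \<bullet> v)) (at x)" for j
  proof -
    have "((\<lambda>x. (x - y j) \<bullet> (x - y j)) has_derivative
        (\<lambda>v. (x - y j) \<bullet> (v - 0) + (v - 0) \<bullet> (x - y j))) (at x)"
      by (intro has_derivative_inner has_derivative_diff has_derivative_ident has_derivative_const)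
    then have "((\<lambda>x. \<phi> j + inverse (2 * t) * ((x - y j) \<bullet> (x - y j))) has_derivative
        (\<lambda>v. 0 + inverse (2 * t) * ((x - y j) \<bullet> (v - 0) + (v - 0) \<bullet> (x - y j)))) (at x)"
      by (intro has_derivative_add has_derivative_const has_derivative_mult_right)
    moreover have "0 + inverse (2 * t) * ((x - y j) \<bullet> (v - 0) + (v - 0) \<bullet> (x - y j)) =
        ((x - y j) /\<^sub>R t) \<bullet> v" for v
      by (simp add: inner_commute[of v])
    ultimately show ?thesis
      unfolding power2_norm_eq_inner by (simp only: divide_inverse mult.commute)
  qed
  from has_derivative_softmin[OF J e, of "\<lambda>x j. \<phi> j + (norm (x - y j))\<^sup>2 / (2 * t)", OF this]
  show ?thesis
    by (simp add: hopf_lax_def[abs_def] hopf_lax_gradient_def hopf_lax_weight_def inner_sum_left mult.assoc)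
qed

lemma hopf_lax_has_time_derivative:
  assumes "t \<noteq> 0"
  shows "((\<lambda>t. hopf_lax e J y \<phi> t x) has_real_derivative hopf_lax_time_derivative e J y \<phi> t x)
    (at t within S)"
proof -
  have "((\<lambda>t. \<phi> j + (norm (x - y j))\<^sup>2 / (2 * t)) has_real_derivative
      - (norm (x - y j))\<^sup>2 / (2 * t\<^sup>2)) (at t within S)" for j
    using assms by (auto intro!: derivative_eq_intros simp: field_simps power2_eq_square)
  from has_real_derivative_softmin[OF J e, of "\<lambda>t j. \<phi> j + (norm (x - y j))\<^sup>2 / (2 * t)", OF this]
  show ?thesis
    by (simp add: hopf_lax_def hopf_lax_time_derivative_def hopf_lax_weight_def
        sum_negf sum_divide_distrib)
qed

text \<open>
  Both sides are averages over the same weights: the gradient is the mean of \<open>(x - y j) / t\<close>, the time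
  derivative is \<open>- 1 / 2\<close> times the mean of its squared norm. For the unsoftened semigroup there is equality,
  but only where it is differentiable; the softening gives an inequality at every point.
\<close>

lemma hopf_lax_hamilton_jacobi:
  "hopf_lax_time_derivative e J y \<phi> t x \<le> - (norm (hopf_lax_gradient e J y \<phi> t x))\<^sup>2 / 2"
proof -
  have "(norm (hopf_lax_gradient e J y \<phi> t x))\<^sup>2 \<le>
      (\<Sum>j\<in>J. hopf_lax_weight e J y \<phi> t x j * (norm ((x - y j) /\<^sub>R t))\<^sup>2)"
    unfolding hopf_lax_gradient_def hopf_lax_weight_def
    using softmin_weight_pos[OF J e] sum_softmin_weight[OF J e]
    by (intro norm_weighted_sum_power2_le) (auto intro: less_imp_le)
  also have "\<dots> = (\<Sum>j\<in>J. hopf_lax_weight e J y \<phi> t x j * (norm (x - y j))\<^sup>2) / t\<^sup>2"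
    by (simp add: power_mult_distrib sum_distrib_left divide_inverse mult_ac power_inverse)
  finally show ?thesis
    by (simp add: hopf_lax_time_derivative_def)
qed

lemma hopf_lax_time_derivative_nonpos: "hopf_lax_time_derivative e J y \<phi> t x \<le> 0"
  by (rule order.trans[OF hopf_lax_hamilton_jacobi]) simp

end

context
  fixes J :: "'i set" and e :: real and y :: "'i \<Rightarrow> 'a::real_inner" and \<phi> :: "'i \<Rightarrow> real"
  assumes J: "finite J" "J \<noteq> {}" and e: "0 < e"
begin

lemma hopf_lax_weight_pos: "0 < hopf_lax_weight e J y \<phi> t x j"
  unfolding hopf_lax_weight_def by (rule softmin_weight_pos[OF J e])

lemma sum_hopf_lax_weight: "(\<Sum>j\<in>J. hopf_lax_weight e J y \<phi> t x j) = 1"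
  unfolding hopf_lax_weight_def by (rule sum_softmin_weight[OF J e])

lemma hopf_lax_weight_le_1: "j \<in> J \<Longrightarrow> hopf_lax_weight e J y \<phi> t x j \<le> 1"
  unfolding hopf_lax_weight_def by (rule softmin_weight_le_1[OF J e])

lemma hopf_lax_le: "j \<in> J \<Longrightarrow> hopf_lax e J y \<phi> t x \<le> \<phi> j + (norm (x - y j))\<^sup>2 / (2 * t)"
  unfolding hopf_lax_def by (rule softmin_le[OF J e])

lemma continuous_on_hopf_lax: "continuous_on S (hopf_lax e J y \<phi> t)"
  by (intro continuous_on_elementary_smooth elementary_smooth_hopf_lax J e)

lemma continuous_on_hopf_lax_weight: "continuous_on S (\<lambda>x. hopf_lax_weight e J y \<phi> t x j)"
proof -
  have "continuous_on S (\<lambda>x. \<phi> j + (norm (x - y j))\<^sup>2 * inverse (2 * t))" for j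
    by (intro continuous_intros)
  then have *: "continuous_on S (\<lambda>x. - (\<phi> j + (norm (x - y j))\<^sup>2 / (2 * t)) / e)" for j
    using e unfolding divide_inverse by (intro continuous_intros)
  have "(\<Sum>k\<in>J. exp (- (\<phi> k + (norm (x - y k))\<^sup>2 / (2 * t)) / e)) \<noteq> 0" for x
    by (rule less_imp_neq[OF softmin_sum_pos[OF J e], symmetric])
  then show ?thesis
    unfolding hopf_lax_weight_def softmin_weight_def
    by (intro continuous_on_divide continuous_on_sum continuous_on_exp * ballI)
qed

lemma continuous_on_hopf_lax_gradient: "continuous_on S (hopf_lax_gradient e J y \<phi> t)"
  unfolding hopf_lax_gradient_def[abs_def]
  by (intro continuous_on_sum continuous_on_scaleR continuous_on_hopf_lax_weight continuous_on_const
      continuous_on_diff continuous_on_id)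

lemma continuous_on_hopf_lax_time_derivative:
  "continuous_on S (hopf_lax_time_derivative e J y \<phi> t)"
proof -
  have "continuous_on S (\<lambda>x. (norm (x - y j))\<^sup>2)" for j
    by (intro continuous_intros)
  then have "continuous_on S (\<lambda>x. \<Sum>j\<in>J. hopf_lax_weight e J y \<phi> t x j * (norm (x - y j))\<^sup>2)"
    by (intro continuous_on_sum continuous_on_mult continuous_on_hopf_lax_weight)
  then show ?thesis
    unfolding hopf_lax_time_derivative_def[abs_def] divide_inverse
    by (intro continuous_on_mult_right continuous_on_minus)
qed

lemma abs_hopf_lax_le:
  assumes L: "\<And>j. j \<in> J \<Longrightarrow> norm (x - y j) \<le> L" and t: "0 < s" "s \<le> t"
  shows "\<bar>hopf_lax e J y \<phi> t x\<bar> \<le> \<bar>softmin e J (\<lambda>_. 0)\<bar> + (\<Sum>j\<in>J. \<bar>\<phi> j\<bar> + L\<^sup>2 / (2 * s))"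
proof -
  have "\<bar>hopf_lax e J y \<phi> t x - softmin e J (\<lambda>_. 0)\<bar> \<le>
      (\<Sum>j\<in>J. \<bar>\<phi> j + (norm (x - y j))\<^sup>2 / (2 * t) - 0\<bar>)"
    unfolding hopf_lax_def by (rule softmin_lipschitz[OF J e])
  also have "\<dots> \<le> (\<Sum>j\<in>J. \<bar>\<phi> j\<bar> + L\<^sup>2 / (2 * s))"
  proof (rule sum_mono)
    fix j assume "j \<in> J"
    then have "(norm (x - y j))\<^sup>2 / (2 * t) \<le> L\<^sup>2 / (2 * s)"
      using L t by (intro frac_le power_mono) auto
    moreover have "0 \<le> (norm (x - y j))\<^sup>2 / (2 * t)" using t by simp
    ultimately show "\<bar>\<phi> j + (norm (x - y j))\<^sup>2 / (2 * t) - 0\<bar> \<le> \<bar>\<phi> j\<bar> + L\<^sup>2 / (2 * s)"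
      by linarith
  qed
  finally show ?thesis by linarith
qed

lemma abs_hopf_lax_time_derivative_le:
  assumes L: "\<And>j. j \<in> J \<Longrightarrow> norm (x - y j) \<le> L" and t: "0 < s" "s \<le> t"
  shows "\<bar>hopf_lax_time_derivative e J y \<phi> t x\<bar> \<le> L\<^sup>2 / (2 * s\<^sup>2)"
proof -
  let ?S = "\<Sum>j\<in>J. hopf_lax_weight e J y \<phi> t x j * (norm (x - y j))\<^sup>2"
  have "?S \<le> (\<Sum>j\<in>J. hopf_lax_weight e J y \<phi> t x j * L\<^sup>2)"
    using L hopf_lax_weight_pos by (intro sum_mono mult_left_mono power_mono) (auto intro: less_imp_le)
  also have "\<dots> = L\<^sup>2"
    by (simp add: sum_hopf_lax_weight flip: sum_distrib_right)
  finally have "?S \<le> L\<^sup>2" .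
  moreover have "0 \<le> ?S"
    using hopf_lax_weight_pos by (intro sum_nonneg mult_nonneg_nonneg) (auto intro: less_imp_le)
  ultimately have "?S / (2 * t\<^sup>2) \<le> L\<^sup>2 / (2 * s\<^sup>2)" "0 \<le> ?S / (2 * t\<^sup>2)"
    using t by (auto intro!: frac_le power_mono)
  then show ?thesis
    by (simp add: hopf_lax_time_derivative_def)
qed

end

section \<open>Differentiation under the integral sign\<close>

text \<open>
  Differentiation under the integral sign: the mean value theorem bounds the difference quotients by \<open>w\<close>,
  so dominated convergence applies along every sequence.
\<close>

lemma has_real_derivative_integral:
  fixes f f' :: "real \<Rightarrow> 'a \<Rightarrow> real"
  assumes t: "a < t" "t < b"
    and f: "\<And>s. a < s \<Longrightarrow> s < b \<Longrightarrow> integrable M (f s)"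
    and f': "f' t \<in> borel_measurable M"
    and deriv: "\<And>s x. a < s \<Longrightarrow> s < b \<Longrightarrow> x \<in> space M \<Longrightarrow>
      ((\<lambda>s. f s x) has_real_derivative f' s x) (at s)"
    and w: "integrable M w"
    and bound: "\<And>s x. a < s \<Longrightarrow> s < b \<Longrightarrow> x \<in> space M \<Longrightarrow> \<bar>f' s x\<bar> \<le> w x"
  shows "((\<lambda>s. \<integral>x. f s x \<partial>M) has_real_derivative (\<integral>x. f' t x \<partial>M)) (at t)"
  unfolding DERIV_def tendsto_at_iff_sequentially comp_def
proof (intro allI impI)
  fix X :: "nat \<Rightarrow> real"
  assume X: "\<forall>i. X i \<in> UNIV - {0}" "X \<longlonglongrightarrow> 0"
  have "\<forall>\<^sub>F i in sequentially. t + X i \<in> {a<..<b}"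
    using tendsto_add[OF tendsto_const[of t] X(2)] t
    by (intro topological_tendstoD[where l = t]) auto
  then obtain N where N: "\<And>i. i \<ge> N \<Longrightarrow> a < t + X i" "\<And>i. i \<ge> N \<Longrightarrow> t + X i < b"
    by (auto simp: eventually_sequentially)
  define Y where "Y i = X (i + N)" for i
  have Y: "Y i \<noteq> 0" "a < t + Y i" "t + Y i < b" for i
    using X(1) N[of "i + N"] by (auto simp: Y_def)
  have Y0: "Y \<longlonglongrightarrow> 0"
    unfolding Y_def using X(2) by (rule LIMSEQ_ignore_initial_segment)
  have "(\<lambda>i. \<integral>x. (f (t + Y i) x - f t x) / Y i \<partial>M) \<longlonglongrightarrow> (\<integral>x. f' t x \<partial>M)"
  proof (rule integral_dominated_convergence[where w = w])
    show "(\<lambda>x. (f (t + Y i) x - f t x) / Y i) \<in> borel_measurable M" for i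
      using f[OF Y(2,3)[of i]] f[OF t] by auto
    show "AE x in M. (\<lambda>i. (f (t + Y i) x - f t x) / Y i) \<longlonglongrightarrow> f' t x"
    proof (rule AE_I2)
      fix x assume "x \<in> space M"
      from deriv[OF t this] have "((\<lambda>h. (f (t + h) x - f t x) / h) \<longlongrightarrow> f' t x) (at 0)"
        by (simp add: DERIV_def)
      then show "(\<lambda>i. (f (t + Y i) x - f t x) / Y i) \<longlonglongrightarrow> f' t x"
        unfolding tendsto_at_iff_sequentially comp_def using Y(1) Y0 by blast
    qed
    show "AE x in M. norm ((f (t + Y i) x - f t x) / Y i) \<le> w x" for i
    proof (rule AE_I2)
      fix x assume x: "x \<in> space M"
      obtain c where c: "a < c" "c < b" and eq: "f (t + Y i) x - f t x = Y i * f' c x"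
      proof (cases "0 < Y i")
        case True
        with MVT2[of t "t + Y i" "\<lambda>s. f s x" "\<lambda>s. f' s x"] obtain c where
          "t < c" "c < t + Y i" "f (t + Y i) x - f t x = (t + Y i - t) * f' c x"
          using deriv[OF _ _ x] t Y(2,3)[of i] by fastforce
        with that[of c] t Y(2,3)[of i] show ?thesis by auto
      next
        case False
        with Y(1)[of i] MVT2[of "t + Y i" t "\<lambda>s. f s x" "\<lambda>s. f' s x"] obtain c where
          "t + Y i < c" "c < t" "f t x - f (t + Y i) x = (t - (t + Y i)) * f' c x"
          using deriv[OF _ _ x] t Y(2,3)[of i] by fastforce
        with that[of c] t Y(2,3)[of i] show ?thesis by auto
      qed
      show "norm ((f (t + Y i) x - f t x) / Y i) \<le> w x"
        using bound[OF c x] Y(1)[of i] by (simp add: eq)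
    qed
  qed (use f' w in auto)
  also have "(\<lambda>i. \<integral>x. (f (t + Y i) x - f t x) / Y i \<partial>M) =
      (\<lambda>i. ((\<integral>x. f (t + Y i) x \<partial>M) - (\<integral>x. f t x \<partial>M)) / Y i)"
    using f[OF Y(2,3)] f[OF t] by simp
  finally show "(\<lambda>i. ((\<integral>x. f (t + X i) x \<partial>M) - (\<integral>x. f t x \<partial>M)) / X i) \<longlonglongrightarrow> (\<integral>x. f' t x \<partial>M)"
    unfolding Y_def by (rule LIMSEQ_offset)
qed

section \<open>Probability measures on compact sets\<close>

locale compact_prob_space = prob_space \<pi>
  for \<pi> :: "'a::euclidean_space measure" +
  fixes M :: "'a set"
  assumes M: "compact M" and sets_eq: "sets \<pi> = sets (restrict_space borel M)"
begin

lemma space_eq: "space \<pi> = M"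
  using sets_eq_imp_space_eq[OF sets_eq] by (simp add: space_restrict_space)

lemma borel_measurable_continuous:
  fixes f :: "'a \<Rightarrow> 'b::topological_space"
  assumes "continuous_on UNIV f"
  shows "f \<in> borel_measurable \<pi>"
  unfolding measurable_cong_sets[OF sets_eq refl]
  by (intro measurable_restrict_space1 borel_measurable_continuous_onI assms)

lemma integrable_continuous_mult:
  fixes f g :: "'a \<Rightarrow> real"
  assumes f: "continuous_on UNIV f" and g: "integrable \<pi> g"
  shows "integrable \<pi> (\<lambda>x. f x * g x)"
proof -
  have "compact (f ` M)"
    by (rule compact_continuous_image[OF continuous_on_subset[OF f] M]) simp
  then obtain B where B: "\<And>x. x \<in> M \<Longrightarrow> \<bar>f x\<bar> \<le> B"
    using compact_imp_bounded[of "f ` M"] by (auto simp: bounded_iff)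
  show ?thesis
  proof (rule Bochner_Integration.integrable_bound[where f = "\<lambda>x. B * \<bar>g x\<bar>"])
    show "integrable \<pi> (\<lambda>x. B * \<bar>g x\<bar>)" using g by simp
    show "(\<lambda>x. f x * g x) \<in> borel_measurable \<pi>"
      using borel_measurable_continuous[OF f] g by auto
    show "AE x in \<pi>. norm (f x * g x) \<le> norm (B * \<bar>g x\<bar>)"
    proof (rule AE_I2)
      fix x assume "x \<in> space \<pi>"
      then have "\<bar>f x\<bar> \<le> \<bar>B\<bar>" using B[of x] by (simp add: space_eq)
      then show "norm (f x * g x) \<le> norm (B * \<bar>g x\<bar>)"
        by (simp add: abs_mult mult_right_mono)
    qed
  qed
qed

lemma integrable_continuous:
  fixes f :: "'a \<Rightarrow> real"
  assumes "continuous_on UNIV f"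
  shows "integrable \<pi> f"
  using integrable_continuous_mult[OF assms, of "\<lambda>_. 1"] by simp

lemma obtain_distance_bound:
  fixes y :: "'i \<Rightarrow> 'a"
  assumes "finite J"
  obtains L where "\<And>x j. x \<in> M \<Longrightarrow> j \<in> J \<Longrightarrow> norm (x - y j) \<le> L"
proof -
  obtain R where R: "\<And>x. x \<in> M \<Longrightarrow> norm x \<le> R"
    using compact_imp_bounded[OF M] unfolding bounded_iff by blast
  show ?thesis
  proof (rule that)
    fix x j assume "x \<in> M" "j \<in> J"
    then have "norm x \<le> R" "norm (y j) \<le> (\<Sum>j\<in>J. norm (y j))"
      using R assms by (auto intro: member_le_sum)
    then show "norm (x - y j) \<le> R + (\<Sum>j\<in>J. norm (y j))"
      using norm_triangle_ineq4[of x "y j"] by linarith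
  qed
qed

text \<open>
  A finite cover of \<open>M\<close> by balls is made disjoint, and the null cells are dropped, since the later construction
  divides by the masses. This is why the remaining cells cover only almost everywhere.
\<close>

lemma obtain_small_cells:
  assumes "0 < \<eta>"
  obtains J :: "nat set" and A y where "finite J" "J \<noteq> {}" "disjoint_family_on A J"
    "\<And>j. j \<in> J \<Longrightarrow> A j \<in> sets \<pi>" "\<And>j. j \<in> J \<Longrightarrow> y j \<in> M" "\<And>j. j \<in> J \<Longrightarrow> 0 < prob (A j)"
    "\<And>j x. j \<in> J \<Longrightarrow> x \<in> A j \<Longrightarrow> norm (x - y j) \<le> \<eta>" "AE x in \<pi>. x \<in> (\<Union>j\<in>J. A j)"
proof -
  obtain k where k: "finite k" "k \<subseteq> M" "M \<subseteq> (\<Union>z\<in>k. ball z \<eta>)"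
    using seq_compact_imp_totally_bounded[of M] M assms
    by (auto simp: compact_eq_seq_compact_metric)
  then obtain n :: nat and y where y: "k = y ` {i. i < n}"
    using finite_imp_nat_seg_image_inj_on by blast
  define A where "A = disjointed (\<lambda>i. if i < n then M \<inter> ball (y i) \<eta> else {})"
  define J where "J = {j. j < n \<and> 0 < prob (A j)}"
  have "M \<inter> ball (y i) \<eta> \<in> sets \<pi>" for i
    unfolding sets_eq by (auto simp: sets_restrict_space)
  then have A: "A j \<in> sets \<pi>" for j
    using sets.range_disjointed_sets[of "\<lambda>i. if i < n then M \<inter> ball (y i) \<eta> else {}" \<pi>]
    unfolding A_def by (auto simp: image_subset_iff)
  have sub: "A j \<subseteq> (if j < n then M \<inter> ball (y j) \<eta> else {})" for j
    unfolding A_def by (rule disjointed_subset)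
  have "M \<subseteq> (\<Union>i. if i < n then M \<inter> ball (y i) \<eta> else {})"
    using k(3) unfolding y by fastforce
  then have cover: "M \<subseteq> (\<Union>i. A i)"
    unfolding A_def UN_disjointed_eq .
  have "AE x in \<pi>. x \<notin> A j" if "j \<notin> J" for j
  proof -
    have "prob (A j) = 0"
      using that sub[of j] measure_nonneg[of \<pi> "A j"] by (cases "j < n") (auto simp: J_def)
    then show ?thesis
      using A by (simp add: AE_iff_measurable[OF A] emeasure_eq_measure prob_eq_0)
  qed
  then have "AE x in \<pi>. \<forall>j. j \<notin> J \<longrightarrow> x \<notin> A j"
    by (simp add: AE_all_countable)
  moreover have "AE x in \<pi>. x \<in> M"
    by (rule AE_I2) (simp add: space_eq)
  ultimately have AE: "AE x in \<pi>. x \<in> (\<Union>j\<in>J. A j)"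
    by eventually_elim (use cover in blast)
  show ?thesis
  proof (rule that)
    show "J \<noteq> {}"
    proof
      assume "J = {}"
      with AE have "AE x in \<pi>. False" by simp
      then show False by simp
    qed
    show "disjoint_family_on A J"
      using disjoint_family_disjointed disjoint_family_on_mono[of J UNIV A] unfolding A_def by blast
    show "norm (x - y j) \<le> \<eta>" if "j \<in> J" "x \<in> A j" for j x
      using that sub[of j] by (auto simp: J_def dist_norm norm_minus_commute split: if_splits)
    show "y j \<in> M" if "j \<in> J" for j
      using that k(2) y by (auto simp: J_def)
    show "0 < prob (A j)" if "j \<in> J" for j
      using that by (simp add: J_def)
    show "AE x in \<pi>. x \<in> (\<Union>j\<in>J. A j)" by (rule AE)
  qed (simp_all add: A J_def)
qed

end

section \<open>Increase along the interpolation of densities\<close>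

text \<open>
  The Poincare inequality is assumed only for test functions defined on the whole space, with their ambient gradients.
  This hides the submanifold from the transport argument.
\<close>

locale poincare_space = compact_prob_space +
  fixes C :: real
  assumes C: "0 < C"
    and poincare: "\<And>f G. elementary_smooth f \<Longrightarrow>
      (\<And>x. (f has_derivative (\<lambda>v. G x \<bullet> v)) (at x)) \<Longrightarrow> integrable \<pi> (\<lambda>x. (norm (G x))\<^sup>2) \<Longrightarrow>
      (\<integral>x. (f x - (\<integral>x. f x \<partial>\<pi>))\<^sup>2 \<partial>\<pi>) \<le> C * (\<integral>x. (norm (G x))\<^sup>2 \<partial>\<pi>)"
begin

text \<open>
  The density runs linearly from 1 at time \<open>d\<close> to \<open>h\<close> at time 1. Starting the path at exactly 1 makes the
  bound uniform in \<open>\<phi>\<close>, which matters because \<open>\<phi>\<close> will be a maximizer whose size is not controlled as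
  \<open>d\<close> tends to 0.
\<close>

lemma hopf_lax_integral_increase:
  fixes h :: "'a \<Rightarrow> real" and y :: "'i \<Rightarrow> 'a"
  assumes h: "h \<in> borel_measurable \<pi>" "integrable \<pi> (\<lambda>x. (h x)\<^sup>2)" "(\<integral>x. h x \<partial>\<pi>) = 1"
    and b: "0 < b" "b \<le> 1" "AE x in \<pi>. b \<le> h x"
    and J: "finite J" "J \<noteq> {}" and e: "0 < e" and d: "0 < d" "d < 1"
  shows "(\<integral>x. hopf_lax e J y \<phi> 1 x * h x \<partial>\<pi>) \<le> (\<integral>x. hopf_lax e J y \<phi> d x \<partial>\<pi>)
    + C * (\<integral>x. (h x - 1)\<^sup>2 \<partial>\<pi>) / (2 * b * (1 - d))"
proof -
  let ?S = "hopf_lax e J y \<phi>" and ?D = "hopf_lax_time_derivative e J y \<phi>"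
    and ?G = "hopf_lax_gradient e J y \<phi>"
  define H where "H = (\<integral>x. (h x - 1)\<^sup>2 \<partial>\<pi>)"
  define k where "k = 1 / (1 - d)"
  have k: "0 < k" using d by (simp add: k_def)
  have int_h: "integrable \<pi> h"
  proof (rule Bochner_Integration.integrable_bound[of _ "\<lambda>x. 1 + (h x)\<^sup>2"])
    show "AE x in \<pi>. norm (h x) \<le> norm (1 + (h x)\<^sup>2)"
    proof (rule AE_I2)
      fix x
      have "0 \<le> (\<bar>h x\<bar> - 1)\<^sup>2" by simp
      then have "2 * \<bar>h x\<bar> \<le> (h x)\<^sup>2 + 1"
        unfolding power2_diff power2_abs by simp
      then show "norm (h x) \<le> norm (1 + (h x)\<^sup>2)" by simp
    qed
  qed (use h in simp_all)
  have int_h1: "integrable \<pi> (\<lambda>x. h x - 1)" using int_h by simp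
  have int_H: "integrable \<pi> (\<lambda>x. (h x - 1)\<^sup>2)"
    using int_h h by (simp add: power2_diff)
  note cont = continuous_on_hopf_lax[OF J e] continuous_on_hopf_lax_time_derivative[OF J e]
  \<comment> \<open>The factor \<open>k\<close> is the speed that makes \<open>\<rho> d = 1\<close> and \<open>\<rho> 1 = h\<close>.\<close>
  define \<rho> where "\<rho> t x = 1 + (t - d) * k * (h x - 1)" for t x
  define f where "f t x = ?S t x * \<rho> t x" for t x
  define f' where "f' t x = ?D t x * \<rho> t x + ?S t x * (k * (h x - 1))" for t x
  have int_\<rho>: "integrable \<pi> (\<rho> t)" for t
    unfolding \<rho>_def using int_h1 by simp
  obtain L where L: "\<And>x j. x \<in> M \<Longrightarrow> j \<in> J \<Longrightarrow> norm (x - y j) \<le> L"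
    using obtain_distance_bound[OF J(1)] by blast
  define B1 where "B1 = \<bar>softmin e J (\<lambda>_. 0)\<bar> + (\<Sum>j\<in>J. \<bar>\<phi> j\<bar> + L\<^sup>2 / (2 * (d / 2)))"
  define B2 where "B2 = L\<^sup>2 / (2 * (d / 2)\<^sup>2)"
  \<comment> \<open>The bound on the time derivative needs times bounded away from 0, hence the lower limit \<open>d / 2\<close>.\<close>
  have deriv: "((\<lambda>s. \<integral>x. f s x \<partial>\<pi>) has_real_derivative (\<integral>x. f' t x \<partial>\<pi>)) (at t)"
    if "d / 2 < t" "t < 2" for t
  proof (rule has_real_derivative_integral[OF that,
        where w = "\<lambda>x. B2 * (1 + 2 * k * \<bar>h x - 1\<bar>) + B1 * (k * \<bar>h x - 1\<bar>)"])
    show "integrable \<pi> (f s)" for s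
      unfolding f_def by (intro integrable_continuous_mult cont int_\<rho>)
    have "integrable \<pi> (f' t)"
      unfolding f'_def using int_h1
      by (intro Bochner_Integration.integrable_add integrable_continuous_mult cont int_\<rho>) simp
    then show "f' t \<in> borel_measurable \<pi>" by simp
    show "integrable \<pi> (\<lambda>x. B2 * (1 + 2 * k * \<bar>h x - 1\<bar>) + B1 * (k * \<bar>h x - 1\<bar>))"
      using int_h1 by simp
    show "((\<lambda>s. f s x) has_real_derivative f' s x) (at s)" if "d / 2 < s" for s x
    proof -
      have "s \<noteq> 0" using that d by simp
      note hopf_lax_has_time_derivative[OF J e this, of y \<phi> x UNIV]
      moreover have "((\<lambda>s. \<rho> s x) has_real_derivative k * (h x - 1)) (at s)"
        unfolding \<rho>_def by (auto intro!: derivative_eq_intros)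
      ultimately show ?thesis
        unfolding f_def f'_def by (intro DERIV_mult[THEN DERIV_cong]) (auto simp: mult.commute)
    qed
    show "\<bar>f' s x\<bar> \<le> B2 * (1 + 2 * k * \<bar>h x - 1\<bar>) + B1 * (k * \<bar>h x - 1\<bar>)"
      if s: "d / 2 < s" "s < 2" and "x \<in> space \<pi>" for s x
    proof -
      have x: "x \<in> M" using that by (simp add: space_eq)
      have S: "\<bar>?S s x\<bar> \<le> B1"
        unfolding B1_def using d s by (intro abs_hopf_lax_le[OF J e] L x) auto
      have D: "\<bar>?D s x\<bar> \<le> B2"
        unfolding B2_def using d s by (intro abs_hopf_lax_time_derivative_le[OF J e] L x) auto
      have "\<bar>s - d\<bar> \<le> 2" using s d by linarith
      then have "\<bar>(s - d) * k * (h x - 1)\<bar> \<le> 2 * k * \<bar>h x - 1\<bar>"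
        using k by (simp add: abs_mult mult_right_mono)
      then have "\<bar>\<rho> s x\<bar> \<le> 1 + 2 * k * \<bar>h x - 1\<bar>"
        unfolding \<rho>_def by linarith
      then have "\<bar>?D s x * \<rho> s x\<bar> \<le> B2 * (1 + 2 * k * \<bar>h x - 1\<bar>)"
        unfolding abs_mult using D by (intro mult_mono) auto
      moreover have "\<bar>?S s x * (k * (h x - 1))\<bar> \<le> B1 * (k * \<bar>h x - 1\<bar>)"
        unfolding abs_mult using S k by (intro mult_mono) auto
      ultimately show ?thesis
        unfolding f'_def by linarith
    qed
  qed
  have f'_le: "(\<integral>x. f' t x \<partial>\<pi>) \<le> C * k\<^sup>2 * H / (2 * b)" if t: "d < t" "t < 1" for t
  proof -
    define E where "E = (\<integral>x. (norm (?G t x))\<^sup>2 \<partial>\<pi>)"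
    define m where "m = (\<integral>x. ?S t x \<partial>\<pi>)"
    have int_E: "integrable \<pi> (\<lambda>x. (norm (?G t x))\<^sup>2)"
      by (intro integrable_continuous continuous_on_power continuous_on_norm
          continuous_on_hopf_lax_gradient J e)
    have int_S: "integrable \<pi> (?S t)"
      by (intro integrable_continuous cont)
    have "(\<integral>x. ?D t x * \<rho> t x \<partial>\<pi>) \<le> (\<integral>x. - (b / 2) * (norm (?G t x))\<^sup>2 \<partial>\<pi>)"
    proof (rule integral_mono_AE)
      show "integrable \<pi> (\<lambda>x. ?D t x * \<rho> t x)"
        by (intro integrable_continuous_mult cont int_\<rho>)
      show "integrable \<pi> (\<lambda>x. - (b / 2) * (norm (?G t x))\<^sup>2)"
        using int_E by simp
      show "AE x in \<pi>. ?D t x * \<rho> t x \<le> - (b / 2) * (norm (?G t x))\<^sup>2"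
        using b(3)
      proof eventually_elim
        fix x assume hx: "b \<le> h x"
        define s where "s = (t - d) * k"
        have s: "0 \<le> s" "s \<le> 1" using t d by (auto simp: s_def k_def field_simps)
        have "b = (1 - s) * b + s * b" by (simp add: algebra_simps)
        also have "\<dots> \<le> (1 - s) * 1 + s * h x"
          using s hx b by (intro add_mono mult_left_mono) auto
        also have "\<dots> = \<rho> t x" by (simp add: \<rho>_def s_def algebra_simps)
        finally have "b \<le> \<rho> t x" .
        then have "?D t x * \<rho> t x \<le> ?D t x * b"
          by (intro mult_left_mono_neg hopf_lax_time_derivative_nonpos J e)
        also have "\<dots> \<le> - (norm (?G t x))\<^sup>2 / 2 * b"
          using b by (intro mult_right_mono hopf_lax_hamilton_jacobi J e) simp
        finally show "?D t x * \<rho> t x \<le> - (b / 2) * (norm (?G t x))\<^sup>2"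
          by (simp add: mult.commute)
      qed
    qed
    also have "\<dots> = - (b / 2) * E" by (simp add: E_def)
    finally have 1: "(\<integral>x. ?D t x * \<rho> t x \<partial>\<pi>) \<le> - (b / 2) * E" .
    have int_var: "integrable \<pi> (\<lambda>x. (?S t x - m)\<^sup>2)"
      by (intro integrable_continuous continuous_on_power continuous_on_diff continuous_on_const cont)
    have "(\<integral>x. (?S t x - m)\<^sup>2 \<partial>\<pi>) \<le> C * E"
      unfolding m_def E_def
      by (intro poincare elementary_smooth_hopf_lax has_derivative_hopf_lax J e int_E)
    then have "b / (2 * C) * (\<integral>x. (?S t x - m)\<^sup>2 \<partial>\<pi>) \<le> b / (2 * C) * (C * E)"
      using b C by (intro mult_left_mono) auto
    also have "\<dots> = b / 2 * E" using C by simp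
    finally have var: "b / (2 * C) * (\<integral>x. (?S t x - m)\<^sup>2 \<partial>\<pi>) \<le> b / 2 * E" .
    have int_Sh: "integrable \<pi> (\<lambda>x. ?S t x * (k * (h x - 1)))"
      using int_h1 by (intro integrable_continuous_mult cont) simp
    \<comment> \<open>As \<open>h - 1\<close> has mean 0, the mean \<open>m\<close> may be subtracted from \<open>?S t\<close>.\<close>
    have "(\<integral>x. ?S t x * (k * (h x - 1)) \<partial>\<pi>) =
        (\<integral>x. ?S t x * (k * (h x - 1)) \<partial>\<pi>) - m * k * (\<integral>x. h x - 1 \<partial>\<pi>)"
      using int_h h(3) by (simp add: prob_space)
    also have "\<dots> = (\<integral>x. ?S t x * (k * (h x - 1)) - m * k * (h x - 1) \<partial>\<pi>)"
      using int_Sh int_h1 by (subst Bochner_Integration.integral_diff) auto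
    also have "\<dots> = (\<integral>x. (?S t x - m) * (k * (h x - 1)) \<partial>\<pi>)"
      by (simp add: algebra_simps)
    also have "\<dots> \<le> (\<integral>x. b / (2 * C) * (?S t x - m)\<^sup>2 + C * k\<^sup>2 / (2 * b) * (h x - 1)\<^sup>2 \<partial>\<pi>)"
    proof (rule integral_mono)
      show "integrable \<pi> (\<lambda>x. (?S t x - m) * (k * (h x - 1)))"
        using int_h1 by (intro integrable_continuous_mult continuous_on_diff continuous_on_const cont) simp
      show "integrable \<pi> (\<lambda>x. b / (2 * C) * (?S t x - m)\<^sup>2 + C * k\<^sup>2 / (2 * b) * (h x - 1)\<^sup>2)"
        using int_var int_H by simp
      show "(?S t x - m) * (k * (h x - 1)) \<le>
          b / (2 * C) * (?S t x - m)\<^sup>2 + C * k\<^sup>2 / (2 * b) * (h x - 1)\<^sup>2" for x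
      proof -
        \<comment> \<open>The weight in the inequality of Young makes the variance term exactly \<open>b / 2 * E\<close>.\<close>
        define u v where "u = ?S t x - m" and "v = k * (h x - 1)"
        have "0 \<le> (b * u - C * v)\<^sup>2 / (2 * b * C)" using b C by simp
        also have "\<dots> = b / (2 * C) * u\<^sup>2 + C / (2 * b) * v\<^sup>2 - u * v"
          using b C by (simp add: field_simps power2_eq_square)
        finally show ?thesis by (simp add: u_def v_def power_mult_distrib)
      qed
    qed
    also have "\<dots> = b / (2 * C) * (\<integral>x. (?S t x - m)\<^sup>2 \<partial>\<pi>) + C * k\<^sup>2 / (2 * b) * H"
      using int_var int_H by (simp add: H_def)
    finally have 2: "(\<integral>x. ?S t x * (k * (h x - 1)) \<partial>\<pi>) \<le> b / 2 * E + C * k\<^sup>2 / (2 * b) * H"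
      using var by linarith
    have "(\<integral>x. f' t x \<partial>\<pi>) = (\<integral>x. ?D t x * \<rho> t x \<partial>\<pi>) + (\<integral>x. ?S t x * (k * (h x - 1)) \<partial>\<pi>)"
      unfolding f'_def
      by (intro Bochner_Integration.integral_add int_Sh integrable_continuous_mult cont int_\<rho>)
    with 1 2 show ?thesis by simp
  qed
  obtain t where t: "d < t" "t < 1"
    and mvt: "(\<integral>x. f 1 x \<partial>\<pi>) - (\<integral>x. f d x \<partial>\<pi>) = (1 - d) * (\<integral>x. f' t x \<partial>\<pi>)"
    using MVT2[of d 1 "\<lambda>s. \<integral>x. f s x \<partial>\<pi>" "\<lambda>s. \<integral>x. f' s x \<partial>\<pi>"] deriv d by force
  have "\<rho> d x = 1" "\<rho> 1 x = h x" for x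
    using d by (auto simp: \<rho>_def k_def)
  then have f_ends: "f 1 x = ?S 1 x * h x" "f d x = ?S d x" for x
    by (auto simp: f_def)
  have "(1 - d) * (\<integral>x. f' t x \<partial>\<pi>) \<le> (1 - d) * (C * k\<^sup>2 * H / (2 * b))"
    using d f'_le[OF t] by (intro mult_left_mono) auto
  also have "\<dots> = (1 - d) * k * (C * H / (2 * b) * k)"
    by (simp add: power2_eq_square)
  also have "\<dots> = C * H / (2 * b * (1 - d))"
    using d by (simp add: k_def)
  finally show ?thesis
    using mvt by (simp add: f_ends H_def)
qed

end

section \<open>Entropic duality with a finite target\<close>

context compact_prob_space
begin

text \<open>
  The witness \<open>\<phi>\<close> maximizes the concave functional \<open>F\<close>, whose partial derivatives are
  \<open>(\<integral>x. hopf_lax_weight e J y \<phi> 1 x j \<partial>\<pi>) - q j\<close>. A maximum exists because \<open>F\<close> does not change when a constant is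
  added to \<open>\<phi>\<close>, and because, once the minimum of \<open>\<phi>\<close> is normalized to 0, positivity of all \<open>q j\<close> makes \<open>F\<close> small
  when some \<open>\<phi> j\<close> is large; so it suffices to search a compact box.
\<close>

lemma entropic_optimality:
  fixes y :: "'i \<Rightarrow> 'a" and q :: "'i \<Rightarrow> real"
  assumes J: "finite J" "J \<noteq> {}" and e: "0 < e"
    and q: "\<And>j. j \<in> J \<Longrightarrow> 0 < q j" "(\<Sum>j\<in>J. q j) = 1"
  obtains \<phi> where "\<And>j. j \<in> J \<Longrightarrow> (\<integral>x. hopf_lax_weight e J y \<phi> 1 x j \<partial>\<pi>) = q j"
proof -
  let ?S = "\<lambda>\<phi>. hopf_lax e J y \<phi> 1"
  define F where "F \<phi> = (\<integral>x. ?S \<phi> x \<partial>\<pi>) - (\<Sum>j\<in>J. q j * \<phi> j)" for \<phi>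
  have int_S: "integrable \<pi> (?S \<phi>)" for \<phi>
    by (intro integrable_continuous continuous_on_hopf_lax J e)
  have q_le_1: "q j \<le> 1" if "j \<in> J" for j
    using member_le_sum[OF that, of q] q J by (auto intro: less_imp_le)
  have F_lip: "F \<phi> \<le> F \<psi> + 2 * (\<Sum>j\<in>J. \<bar>\<phi> j - \<psi> j\<bar>)" for \<phi> \<psi>
  proof -
    have "?S \<phi> x \<le> ?S \<psi> x + (\<Sum>j\<in>J. \<bar>\<phi> j - \<psi> j\<bar>)" for x
      using softmin_lipschitz[OF J e, of "\<lambda>j. \<phi> j + (norm (x - y j))\<^sup>2 / (2 * 1)"
          "\<lambda>j. \<psi> j + (norm (x - y j))\<^sup>2 / (2 * 1)"]
      by (simp add: hopf_lax_def)
    then have "(\<integral>x. ?S \<phi> x \<partial>\<pi>) \<le> (\<integral>x. ?S \<psi> x + (\<Sum>j\<in>J. \<bar>\<phi> j - \<psi> j\<bar>) \<partial>\<pi>)"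
      using int_S by (intro integral_mono) auto
    also have "\<dots> = (\<integral>x. ?S \<psi> x \<partial>\<pi>) + (\<Sum>j\<in>J. \<bar>\<phi> j - \<psi> j\<bar>)"
      using int_S by (simp add: prob_space)
    finally have 1: "(\<integral>x. ?S \<phi> x \<partial>\<pi>) \<le> (\<integral>x. ?S \<psi> x \<partial>\<pi>) + (\<Sum>j\<in>J. \<bar>\<phi> j - \<psi> j\<bar>)" .
    have "(\<Sum>j\<in>J. q j * \<psi> j) - (\<Sum>j\<in>J. q j * \<phi> j) = (\<Sum>j\<in>J. q j * (\<psi> j - \<phi> j))"
      by (simp add: sum_subtractf right_diff_distrib)
    also have "\<dots> \<le> (\<Sum>j\<in>J. \<bar>\<phi> j - \<psi> j\<bar>)"
    proof (rule sum_mono)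
      fix j assume j: "j \<in> J"
      have "q j * (\<psi> j - \<phi> j) \<le> q j * \<bar>\<phi> j - \<psi> j\<bar>"
        using q(1)[OF j] by (intro mult_left_mono) auto
      also have "\<dots> \<le> 1 * \<bar>\<phi> j - \<psi> j\<bar>"
        using q_le_1[OF j] by (intro mult_right_mono) auto
      finally show "q j * (\<psi> j - \<phi> j) \<le> \<bar>\<phi> j - \<psi> j\<bar>" by simp
    qed
    finally show ?thesis using 1 by (simp add: F_def)
  qed
  have F_shift: "F (\<lambda>j. \<phi> j + c) = F \<phi>" for \<phi> c
  proof -
    have "?S (\<lambda>j. \<phi> j + c) x = ?S \<phi> x + c" for x
      using softmin_add_const[OF J e, of "\<lambda>j. \<phi> j + (norm (x - y j))\<^sup>2 / (2 * 1)" c]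
      by (simp add: hopf_lax_def algebra_simps)
    then show ?thesis
      using int_S by (simp add: F_def prob_space distrib_left sum.distrib q(2) flip: sum_distrib_right)
  qed
  obtain L where L: "\<And>x j. x \<in> M \<Longrightarrow> j \<in> J \<Longrightarrow> norm (x - y j) \<le> L"
    using obtain_distance_bound[OF J(1)] by blast
  have F_coercive: "F \<phi> \<le> L\<^sup>2 / 2 - q j * \<phi> j"
    if nonneg: "\<And>j. j \<in> J \<Longrightarrow> 0 \<le> \<phi> j" and k: "k \<in> J" "\<phi> k = 0" and j: "j \<in> J" for \<phi> k j
  proof -
    have "?S \<phi> x \<le> L\<^sup>2 / 2" if "x \<in> space \<pi>" for x
    proof -
      have "(norm (x - y k))\<^sup>2 \<le> L\<^sup>2"
        using L[of x k] k that by (intro power_mono) (auto simp: space_eq)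
      then show ?thesis
        using hopf_lax_le[OF J e k(1), of y \<phi> 1 x] k by simp
    qed
    then have "(\<integral>x. ?S \<phi> x \<partial>\<pi>) \<le> (\<integral>x. L\<^sup>2 / 2 \<partial>\<pi>)"
      using int_S by (intro integral_mono) auto
    moreover have "q j * \<phi> j \<le> (\<Sum>j\<in>J. q j * \<phi> j)"
      using J j nonneg q(1) by (intro member_le_sum mult_nonneg_nonneg) (auto intro: less_imp_le)
    ultimately show ?thesis
      by (simp add: F_def prob_space)
  qed
  \<comment> \<open>The size of the box: where a coordinate exceeds \<open>B\<close>, coercivity puts \<open>F\<close> below its value at 0.\<close>
  define B where "B = (\<Sum>j\<in>J. \<bar>L\<^sup>2 / 2 - F (\<lambda>_. 0)\<bar> / q j)"
  have B: "L\<^sup>2 / 2 - q j * B \<le> F (\<lambda>_. 0)" if j: "j \<in> J" for j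
  proof -
    have "\<bar>L\<^sup>2 / 2 - F (\<lambda>_. 0)\<bar> / q j \<le> B"
      unfolding B_def using J j q(1)
      by (intro member_le_sum divide_nonneg_pos) auto
    then have "\<bar>L\<^sup>2 / 2 - F (\<lambda>_. 0)\<bar> \<le> q j * B"
      using q(1)[OF j] by (simp add: pos_divide_le_eq mult.commute)
    then show ?thesis by linarith
  qed
  have B_nonneg: "0 \<le> B"
    unfolding B_def using q(1) by (intro sum_nonneg divide_nonneg_pos) auto
  \<comment> \<open>Coordinates outside \<open>J\<close> are pinned to 0, so that the box is compact in the product topology on all functions.\<close>
  define K where "K = (\<Pi>\<^sub>E i\<in>UNIV. if i \<in> J then {0..B} else {0})"
  have "compactin (product_topology (\<lambda>_. euclidean) UNIV) K"
    unfolding K_def compactin_PiE by (auto simp: compactin_euclidean_iff)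
  then have "compact K"
    by (simp add: euclidean_product_topology flip: compactin_euclidean_iff)
  moreover have zero: "(\<lambda>_. 0) \<in> K"
    using B_nonneg by (auto simp: K_def)
  moreover have "continuous_on K F"
    unfolding continuous_on_def
  proof
    fix \<phi> assume "\<phi> \<in> K"
    have "((\<lambda>\<psi>. \<psi> j) \<longlongrightarrow> \<phi> j) (at \<phi> within K)" for j
      using continuous_on_subset[OF continuous_on_product_coordinates[of j] subset_UNIV, of K] \<open>\<phi> \<in> K\<close>
      by (simp add: continuous_on_def)
    then have "((\<lambda>\<psi>. 2 * (\<Sum>j\<in>J. \<bar>\<phi> j - \<psi> j\<bar>)) \<longlongrightarrow> 2 * (\<Sum>j\<in>J. \<bar>\<phi> j - \<phi> j\<bar>)) (at \<phi> within K)"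
      by (intro tendsto_intros)
    then have "((\<lambda>\<psi>. 2 * (\<Sum>j\<in>J. \<bar>\<phi> j - \<psi> j\<bar>)) \<longlongrightarrow> 0) (at \<phi> within K)"
      by simp
    moreover have "\<forall>\<^sub>F \<psi> in at \<phi> within K. norm (F \<psi> - F \<phi>) \<le> 2 * (\<Sum>j\<in>J. \<bar>\<phi> j - \<psi> j\<bar>)"
    proof (rule always_eventually, rule allI)
      fix \<psi>
      show "norm (F \<psi> - F \<phi>) \<le> 2 * (\<Sum>j\<in>J. \<bar>\<phi> j - \<psi> j\<bar>)"
        using F_lip[of \<phi> \<psi>] F_lip[of \<psi> \<phi>] by (auto simp: abs_le_iff abs_minus_commute)
    qed
    ultimately have "((\<lambda>\<psi>. F \<psi> - F \<phi>) \<longlongrightarrow> 0) (at \<phi> within K)"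
      by (rule Lim_null_comparison[rotated])
    then show "(F \<longlongrightarrow> F \<phi>) (at \<phi> within K)"
      by (simp add: LIM_zero_iff)
  qed
  ultimately obtain \<phi> where \<phi>: "\<phi> \<in> K" "\<And>\<psi>. \<psi> \<in> K \<Longrightarrow> F \<psi> \<le> F \<phi>"
    using continuous_attains_sup[of K F] by blast
  have max: "F \<psi> \<le> F \<phi>" for \<psi>
  proof -
    obtain k where k: "k \<in> J" "\<And>j. j \<in> J \<Longrightarrow> \<psi> k \<le> \<psi> j"
      using finite_has_minimal[of "\<psi> ` J"] J
      by (metis (mono_tags, lifting) arg_min_if_finite(1) arg_min_least)
    define \<psi>' where "\<psi>' j = (if j \<in> J then \<psi> j - \<psi> k else 0)" for j
    have "F \<psi> \<le> F (\<lambda>j. \<psi>' j + \<psi> k)"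
      using F_lip[of \<psi> "\<lambda>j. \<psi>' j + \<psi> k"] by (simp add: \<psi>'_def)
    then have "F \<psi> \<le> F \<psi>'" by (simp only: F_shift)
    also have "F \<psi>' \<le> F \<phi>"
    proof (cases "\<psi>' \<in> K")
      case False
      then obtain j where j: "j \<in> J" "B < \<psi>' j"
        using k by (force simp: K_def \<psi>'_def PiE_iff split: if_splits)
      have "F \<psi>' \<le> L\<^sup>2 / 2 - q j * \<psi>' j"
        using k j by (intro F_coercive[OF _ k(1) _ j(1)]) (auto simp: \<psi>'_def)
      also have "\<dots> \<le> L\<^sup>2 / 2 - q j * B"
        using j q(1)[OF j(1)] by simp
      also have "\<dots> \<le> F (\<lambda>_. 0)" by (rule B[OF j(1)])
      also have "\<dots> \<le> F \<phi>" by (rule \<phi>(2)[OF zero])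
      finally show ?thesis .
    qed (rule \<phi>(2))
    finally show ?thesis .
  qed
  show ?thesis
  proof (rule that)
    fix j assume j: "j \<in> J"
    \<comment> \<open>At the maximum the derivative in the direction of the single coordinate \<open>j\<close> vanishes.\<close>
    define \<Phi> where "\<Phi> t = \<phi>(j := \<phi> j + t)" for t
    have "((\<lambda>t. \<integral>x. ?S (\<Phi> t) x \<partial>\<pi>) has_real_derivative
        (\<integral>x. hopf_lax_weight e J y (\<Phi> 0) 1 x j \<partial>\<pi>)) (at 0)"
    proof (rule has_real_derivative_integral[where a = "-1" and b = 1 and w = "\<lambda>_. 1"
          and f' = "\<lambda>t x. hopf_lax_weight e J y (\<Phi> t) 1 x j"])
      show "integrable \<pi> (?S (\<Phi> s))" for s by (rule int_S)
      show "(\<lambda>x. hopf_lax_weight e J y (\<Phi> 0) 1 x j) \<in> borel_measurable \<pi>"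
        by (intro borel_measurable_continuous continuous_on_hopf_lax_weight J e)
      show "\<bar>hopf_lax_weight e J y (\<Phi> s) 1 x j\<bar> \<le> 1" for s x
        using hopf_lax_weight_pos[OF J e, of y "\<Phi> s" 1 x j]
          hopf_lax_weight_le_1[OF J e j, of y "\<Phi> s" 1 x] by simp
      show "((\<lambda>s. ?S (\<Phi> s) x) has_real_derivative hopf_lax_weight e J y (\<Phi> s) 1 x j) (at s)" for s x
      proof -
        have "((\<lambda>s. \<Phi> s i + (norm (x - y i))\<^sup>2 / (2 * 1)) has_real_derivative
            (if i = j then 1 else 0)) (at s)" for i
          by (auto simp: \<Phi>_def intro!: derivative_eq_intros)
        from has_real_derivative_softmin[OF J e,
            of "\<lambda>s i. \<Phi> s i + (norm (x - y i))\<^sup>2 / (2 * 1)", OF this]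
        show ?thesis
          using J j by (simp add: hopf_lax_def hopf_lax_weight_def if_distrib cong: if_cong)
      qed
    qed auto
    moreover have "((\<lambda>t. \<Sum>i\<in>J. q i * \<Phi> t i) has_real_derivative q j) (at 0)"
    proof -
      have "((\<lambda>t. q i * \<Phi> t i) has_real_derivative (if i = j then q j else 0)) (at 0)" for i
        by (auto simp: \<Phi>_def intro!: derivative_eq_intros)
      then have "((\<lambda>t. \<Sum>i\<in>J. q i * \<Phi> t i) has_real_derivative
          (\<Sum>i\<in>J. if i = j then q j else 0)) (at 0)"
        by (intro DERIV_sum)
      then show ?thesis using J j by simp
    qed
    ultimately have "((\<lambda>t. F (\<Phi> t)) has_real_derivative
        (\<integral>x. hopf_lax_weight e J y (\<Phi> 0) 1 x j \<partial>\<pi>) - q j) (at 0)"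
      unfolding F_def by (rule DERIV_diff)
    moreover have \<Phi>0: "\<Phi> 0 = \<phi>" by (simp add: \<Phi>_def)
    ultimately have "(\<integral>x. hopf_lax_weight e J y \<phi> 1 x j \<partial>\<pi>) - q j = 0"
      using max by (intro DERIV_local_max[of "\<lambda>t. F (\<Phi> t)" _ 0 1]) auto
    then show "(\<integral>x. hopf_lax_weight e J y \<phi> 1 x j \<partial>\<pi>) = q j" by simp
  qed
qed

text \<open>
  At stationary heights the cost of the coupling from the weights is, up to the entropy error, twice the dual
  functional, as \<open>\<integral> (\<Sum>j\<in>J. w j * \<phi> j)\<close> turns into \<open>\<Sum>j\<in>J. q j * \<phi> j\<close>. The factor 2 comes from the cost
  \<open>(norm (x - y j))\<^sup>2 / 2\<close> in \<open>hopf_lax\<close> at time 1.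
\<close>

lemma hopf_lax_weighted_cost:
  fixes y :: "'i \<Rightarrow> 'a"
  assumes J: "finite J" "J \<noteq> {}" and e: "0 < e"
    and q: "\<And>j. j \<in> J \<Longrightarrow> (\<integral>x. hopf_lax_weight e J y \<phi> 1 x j \<partial>\<pi>) = q j"
  shows "(\<integral>x. (\<Sum>j\<in>J. hopf_lax_weight e J y \<phi> 1 x j * (norm (x - y j))\<^sup>2) \<partial>\<pi>) \<le>
    2 * ((\<integral>x. hopf_lax e J y \<phi> 1 x \<partial>\<pi>) - (\<Sum>j\<in>J. q j * \<phi> j) + e * real (card J))"
proof -
  let ?w = "hopf_lax_weight e J y \<phi> 1"
  have int_w: "integrable \<pi> (\<lambda>x. ?w x j)" for j
    by (intro integrable_continuous continuous_on_hopf_lax_weight J e)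
  have int_S: "integrable \<pi> (hopf_lax e J y \<phi> 1)"
    by (intro integrable_continuous continuous_on_hopf_lax J e)
  have "continuous_on UNIV (\<lambda>x::'a. (norm (x - y j))\<^sup>2)" for j
    by (intro continuous_intros)
  then have int_cost: "integrable \<pi> (\<lambda>x. \<Sum>j\<in>J. ?w x j * (norm (x - y j))\<^sup>2)"
    by (intro integrable_continuous continuous_on_sum continuous_on_mult
        continuous_on_hopf_lax_weight J e)
  have "(\<Sum>j\<in>J. ?w x j * (norm (x - y j))\<^sup>2) \<le>
      2 * (hopf_lax e J y \<phi> 1 x + e * real (card J) - (\<Sum>j\<in>J. ?w x j * \<phi> j))" for x
    using sum_softmin_weight_le[OF J e, of "\<lambda>j. \<phi> j + (norm (x - y j))\<^sup>2 / (2 * 1)"]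
    by (simp add: hopf_lax_def hopf_lax_weight_def distrib_left sum.distrib flip: sum_divide_distrib)
  then have "(\<integral>x. (\<Sum>j\<in>J. ?w x j * (norm (x - y j))\<^sup>2) \<partial>\<pi>) \<le>
      (\<integral>x. 2 * (hopf_lax e J y \<phi> 1 x + e * real (card J) - (\<Sum>j\<in>J. ?w x j * \<phi> j)) \<partial>\<pi>)"
    using int_cost int_S int_w by (intro integral_mono) auto
  also have "\<dots> = 2 * ((\<integral>x. hopf_lax e J y \<phi> 1 x \<partial>\<pi>) + e * real (card J) - (\<Sum>j\<in>J. q j * \<phi> j))"
    using int_S int_w by (simp add: prob_space q)
  finally show ?thesis by (simp add: algebra_simps)
qed

end

section \<open>Couplings from weights on cells\<close>

text \<open>
  The coupling sends \<open>x\<close> to the cell \<open>A j\<close> with probability \<open>w j x\<close> and, inside the cell, to a point distributed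
  as \<open>\<pi>\<close> conditioned on that cell. Its first marginal is \<open>\<mu>\<close> because the weights sum to 1; its second is \<open>\<pi>\<close> because
  cell \<open>j\<close> receives the total mass \<open>\<integral> w j d\<mu>\<close>, which is its \<open>\<pi>\<close>-measure.
\<close>

lemma transport_cost2_le_semidiscrete:
  fixes \<mu> \<pi> :: "'a::euclidean_space measure" and w :: "'i \<Rightarrow> 'a \<Rightarrow> real"
  assumes \<mu>: "prob_space \<mu>" and \<pi>: "prob_space \<pi>"
    and J: "finite J" and A: "\<And>j. j \<in> J \<Longrightarrow> A j \<in> sets \<pi>" "disjoint_family_on A J"
      "AE y in \<pi>. y \<in> (\<Union>j\<in>J. A j)" "\<And>j. j \<in> J \<Longrightarrow> 0 < measure \<pi> (A j)"
    and w: "\<And>j. j \<in> J \<Longrightarrow> w j \<in> borel_measurable \<mu>" "\<And>j x. j \<in> J \<Longrightarrow> 0 \<le> w j x"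
      "\<And>x. (\<Sum>j\<in>J. w j x) = 1" "\<And>j. j \<in> J \<Longrightarrow> integrable \<mu> (w j)"
      "\<And>j. j \<in> J \<Longrightarrow> (\<integral>x. w j x \<partial>\<mu>) = measure \<pi> (A j)"
    and cost_meas: "(\<lambda>z. (norm (fst z - snd z))\<^sup>2) \<in> borel_measurable (\<mu> \<Otimes>\<^sub>M \<pi>)"
    and c: "\<And>j x y. j \<in> J \<Longrightarrow> x \<in> space \<mu> \<Longrightarrow> y \<in> A j \<Longrightarrow> (norm (x - y))\<^sup>2 \<le> c j x"
      "\<And>j x. j \<in> J \<Longrightarrow> 0 \<le> c j x"
  shows "transport_cost2 \<mu> \<pi> \<le> (\<integral>\<^sup>+x. ennreal (\<Sum>j\<in>J. w j x * c j x) \<partial>\<mu>)"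
proof -
  interpret \<mu>: prob_space \<mu> by fact
  interpret \<pi>: prob_space \<pi> by fact
  interpret pair_sigma_finite \<mu> \<pi> ..
  define q where "q j = measure \<pi> (A j)" for j
  have q: "0 < q j" if "j \<in> J" for j using A(4)[OF that] by (simp add: q_def)
  have emeasure_A: "emeasure \<pi> (A j) = ennreal (q j)" for j
    by (simp add: q_def \<pi>.emeasure_eq_measure)
  \<comment> \<open>The density of the coupling with respect to the product measure.\<close>
  define k where "k x y = (\<Sum>j\<in>J. ennreal (w j x / q j) * indicator (A j) y)" for x y
  have k_meas: "case_prod k \<in> borel_measurable (\<mu> \<Otimes>\<^sub>M \<pi>)"
    unfolding k_def split_beta' using w(1) A(1) by measurable
  have k_sum: "(\<integral>\<^sup>+y. k x y \<partial>\<pi>) = 1" for x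
  proof -
    have "(\<integral>\<^sup>+y. k x y \<partial>\<pi>) = (\<Sum>j\<in>J. ennreal (w j x / q j) * emeasure \<pi> (A j))"
      unfolding k_def using A(1) by (simp add: nn_integral_sum nn_integral_cmult)
    also have "\<dots> = (\<Sum>j\<in>J. ennreal (w j x))"
    proof (rule sum.cong[OF refl])
      fix j assume j: "j \<in> J"
      have "ennreal (w j x / q j) * ennreal (q j) = ennreal (w j x / q j * q j)"
        by (rule ennreal_mult''[symmetric]) (use q[OF j] in simp)
      then show "ennreal (w j x / q j) * emeasure \<pi> (A j) = ennreal (w j x)"
        using q[OF j] by (simp add: emeasure_A)
    qed
    also have "\<dots> = 1"
      using w(2,3) by simp
    finally show ?thesis .
  qed
  have nn_w: "(\<integral>\<^sup>+x. ennreal (w j x / q j) \<partial>\<mu>) = 1" if j: "j \<in> J" for j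
  proof -
    have "(\<integral>\<^sup>+x. ennreal (w j x / q j) \<partial>\<mu>) = ennreal (\<integral>x. w j x / q j \<partial>\<mu>)"
      using w(2,4)[OF j] q[OF j] by (intro nn_integral_eq_integral) (auto intro: less_imp_le)
    also have "\<dots> = 1" using w(5)[OF j] q[OF j] by (simp add: q_def)
    finally show ?thesis .
  qed
  have k_marginal: "AE y in \<pi>. (\<integral>\<^sup>+x. k x y \<partial>\<mu>) = 1"
    using A(3)
  proof eventually_elim
    fix y assume "y \<in> (\<Union>j\<in>J. A j)"
    then obtain i where i: "i \<in> J" "y \<in> A i" by blast
    have "(\<integral>\<^sup>+x. k x y \<partial>\<mu>) = (\<Sum>j\<in>J. (\<integral>\<^sup>+x. ennreal (w j x / q j) \<partial>\<mu>) * indicator (A j) y)"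
      unfolding k_def using w(1) by (simp add: nn_integral_sum nn_integral_multc)
    also have "\<dots> = (\<Sum>j\<in>J. indicator (A j) y)"
      by (simp add: nn_w)
    also have "\<dots> = (\<Sum>j\<in>J. if j = i then 1 else 0)"
      using i A(2) by (intro sum.cong refl) (auto simp: disjoint_family_on_def indicator_def)
    also have "\<dots> = 1" using i J by simp
    finally show "(\<integral>\<^sup>+x. k x y \<partial>\<mu>) = 1" .
  qed
  define \<gamma> where "\<gamma> = density (\<mu> \<Otimes>\<^sub>M \<pi>) (case_prod k)"
  have sets_\<gamma>: "sets \<gamma> = sets (\<mu> \<Otimes>\<^sub>M \<pi>)" by (simp add: \<gamma>_def)
  have "distr \<gamma> \<mu> fst = \<mu>"
  proof (rule measure_eqI)
    fix B assume "B \<in> sets (distr \<gamma> \<mu> fst)"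
    then have B[measurable]: "B \<in> sets \<mu>" by simp
    have "emeasure (distr \<gamma> \<mu> fst) B = emeasure \<gamma> (fst -` B \<inter> space (\<mu> \<Otimes>\<^sub>M \<pi>))"
      by (subst emeasure_distr) (auto simp: \<gamma>_def)
    also have "\<dots> = (\<integral>\<^sup>+z. case_prod k z * indicator (fst -` B \<inter> space (\<mu> \<Otimes>\<^sub>M \<pi>)) z \<partial>(\<mu> \<Otimes>\<^sub>M \<pi>))"
      unfolding \<gamma>_def using k_meas by (intro emeasure_density) auto
    also have "\<dots> = (\<integral>\<^sup>+z. case_prod k z * indicator B (fst z) \<partial>(\<mu> \<Otimes>\<^sub>M \<pi>))"
      by (intro nn_integral_cong) (simp add: indicator_def)
    also have "\<dots> = (\<integral>\<^sup>+x. \<integral>\<^sup>+y. k x y * indicator B x \<partial>\<pi> \<partial>\<mu>)"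
      using k_meas by (subst \<pi>.nn_integral_fst[symmetric]) auto
    also have "\<dots> = (\<integral>\<^sup>+x. indicator B x \<partial>\<mu>)"
    proof (rule nn_integral_cong)
      fix x assume "x \<in> space \<mu>"
      then have "k x \<in> borel_measurable \<pi>"
        using measurable_Pair2[OF k_meas] by simp
      then show "(\<integral>\<^sup>+y. k x y * indicator B x \<partial>\<pi>) = indicator B x"
        by (simp add: nn_integral_multc k_sum)
    qed
    also have "\<dots> = emeasure \<mu> B" by simp
    finally show "emeasure (distr \<gamma> \<mu> fst) B = emeasure \<mu> B" .
  qed simp
  moreover have "distr \<gamma> \<pi> snd = \<pi>"
  proof (rule measure_eqI)
    fix B assume "B \<in> sets (distr \<gamma> \<pi> snd)"
    then have B[measurable]: "B \<in> sets \<pi>" by simp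
    have "emeasure (distr \<gamma> \<pi> snd) B = emeasure \<gamma> (snd -` B \<inter> space (\<mu> \<Otimes>\<^sub>M \<pi>))"
      by (subst emeasure_distr) (auto simp: \<gamma>_def)
    also have "\<dots> = (\<integral>\<^sup>+z. case_prod k z * indicator (snd -` B \<inter> space (\<mu> \<Otimes>\<^sub>M \<pi>)) z \<partial>(\<mu> \<Otimes>\<^sub>M \<pi>))"
      unfolding \<gamma>_def using k_meas by (intro emeasure_density) auto
    also have "\<dots> = (\<integral>\<^sup>+z. (\<lambda>(x, y). k x y * indicator B y) z \<partial>(\<mu> \<Otimes>\<^sub>M \<pi>))"
      by (intro nn_integral_cong) (auto simp: indicator_def)
    also have "\<dots> = (\<integral>\<^sup>+y. \<integral>\<^sup>+x. k x y * indicator B y \<partial>\<mu> \<partial>\<pi>)"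
      using k_meas by (subst nn_integral_snd[symmetric]) (auto simp: split_beta')
    also have "\<dots> = (\<integral>\<^sup>+y. indicator B y \<partial>\<pi>)"
    proof (rule nn_integral_cong_AE)
      show "AE y in \<pi>. (\<integral>\<^sup>+x. k x y * indicator B y \<partial>\<mu>) = indicator B y"
        using k_marginal AE_space
      proof eventually_elim
        fix y assume "(\<integral>\<^sup>+x. k x y \<partial>\<mu>) = 1" "y \<in> space \<pi>"
        moreover from this have "(\<lambda>x. k x y) \<in> borel_measurable \<mu>"
          using measurable_Pair1[OF k_meas] by simp
        ultimately show "(\<integral>\<^sup>+x. k x y * indicator B y \<partial>\<mu>) = indicator B y"
          by (simp add: nn_integral_multc)
      qed
    qed
    also have "\<dots> = emeasure \<pi> B" by simp
    finally show "emeasure (distr \<gamma> \<pi> snd) B = emeasure \<pi> B" .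
  qed simp
  ultimately have "\<gamma> \<in> couplings \<mu> \<pi>"
    by (simp add: couplings_def sets_\<gamma>)
  then have "transport_cost2 \<mu> \<pi> \<le> (\<integral>\<^sup>+z. ennreal ((norm (fst z - snd z))\<^sup>2) \<partial>\<gamma>)"
    unfolding transport_cost2_def by (rule INF_lower)
  also have "\<dots> = (\<integral>\<^sup>+z. case_prod k z * ennreal ((norm (fst z - snd z))\<^sup>2) \<partial>(\<mu> \<Otimes>\<^sub>M \<pi>))"
    unfolding \<gamma>_def using k_meas cost_meas by (intro nn_integral_density) auto
  also have "\<dots> = (\<integral>\<^sup>+x. \<integral>\<^sup>+y. k x y * ennreal ((norm (x - y))\<^sup>2) \<partial>\<pi> \<partial>\<mu>)"
    using k_meas cost_meas by (subst \<pi>.nn_integral_fst[symmetric]) auto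
  also have "\<dots> \<le> (\<integral>\<^sup>+x. ennreal (\<Sum>j\<in>J. w j x * c j x) \<partial>\<mu>)"
  proof (rule nn_integral_mono)
    fix x assume x: "x \<in> space \<mu>"
    have "(\<integral>\<^sup>+y. k x y * ennreal ((norm (x - y))\<^sup>2) \<partial>\<pi>) \<le>
        (\<integral>\<^sup>+y. (\<Sum>j\<in>J. ennreal (w j x / q j * c j x) * indicator (A j) y) \<partial>\<pi>)"
    proof (rule nn_integral_mono)
      fix y
      have "ennreal (w j x / q j) * indicator (A j) y * ennreal ((norm (x - y))\<^sup>2) \<le>
          ennreal (w j x / q j * c j x) * indicator (A j) y" if j: "j \<in> J" for j
      proof (cases "y \<in> A j")
        case True
        have "w j x / q j * (norm (x - y))\<^sup>2 \<le> w j x / q j * c j x"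
          using c(1)[OF j x True] w(2)[OF j] q[OF j]
          by (intro mult_left_mono divide_nonneg_pos) auto
        with True w(2)[OF j] q[OF j] show ?thesis
          by (simp add: less_imp_le ennreal_leI flip: ennreal_mult')
      qed simp
      then show "k x y * ennreal ((norm (x - y))\<^sup>2) \<le>
          (\<Sum>j\<in>J. ennreal (w j x / q j * c j x) * indicator (A j) y)"
        unfolding k_def sum_distrib_right by (rule sum_mono)
    qed
    also have "\<dots> = (\<Sum>j\<in>J. ennreal (w j x / q j * c j x) * emeasure \<pi> (A j))"
      using A(1) by (simp add: nn_integral_sum nn_integral_cmult)
    also have "\<dots> = (\<Sum>j\<in>J. ennreal (w j x * c j x))"
    proof (rule sum.cong[OF refl])
      fix j assume j: "j \<in> J"
      have "ennreal (w j x / q j * c j x) * ennreal (q j) = ennreal (w j x / q j * c j x * q j)"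
        by (rule ennreal_mult''[symmetric]) (use q[OF j] in simp)
      also have "w j x / q j * c j x * q j = w j x * c j x"
        using q[OF j] by simp
      finally show "ennreal (w j x / q j * c j x) * emeasure \<pi> (A j) = ennreal (w j x * c j x)"
        by (simp add: emeasure_A)
    qed
    also have "\<dots> = ennreal (\<Sum>j\<in>J. w j x * c j x)"
      using w(2) c(2) by simp
    finally show "(\<integral>\<^sup>+y. k x y * ennreal ((norm (x - y))\<^sup>2) \<partial>\<pi>) \<le> ennreal (\<Sum>j\<in>J. w j x * c j x)" .
  qed
  finally show ?thesis .
qed

section \<open>Transport cost under a Poincare inequality\<close>

text \<open>
  A single parameter \<open>d\<close> serves as the starting time of the flow, as the radius of the cells, and, through
  \<open>e = d / card J\<close>, as the total entropy error. Cells of radius \<open>d\<close> cost only \<open>d\<^sup>2 / (2 * d)\<close> at time \<open>d\<close>, so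
  everything but the main term vanishes as \<open>d\<close> tends to 0.
\<close>

lemma (in poincare_space) transport_cost2_density_le:
  assumes h: "h \<in> borel_measurable \<pi>" "integrable \<pi> (\<lambda>x. (h x)\<^sup>2)"
    and \<mu>: "prob_space (density \<pi> (\<lambda>x. ennreal (h x)))"
    and b: "0 < b" "b \<le> 1" "AE x in \<pi>. b \<le> h x"
  shows "transport_cost2 (density \<pi> (\<lambda>x. ennreal (h x))) \<pi> \<le>
    ennreal (C * (\<integral>x. (h x - 1)\<^sup>2 \<partial>\<pi>) / b)"
proof -
  define \<mu> where "\<mu> = density \<pi> (\<lambda>x. ennreal (h x))"
  define H where "H = (\<integral>x. (h x - 1)\<^sup>2 \<partial>\<pi>)"
  have h_nonneg: "AE x in \<pi>. 0 \<le> h x"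
    using b(3) by eventually_elim (use b(1) in simp)
  interpret \<mu>: compact_prob_space \<mu> M
    using \<mu> M sets_eq
    by (simp add: compact_prob_space_def compact_prob_space_axioms_def \<mu>_def)
  have integral_\<mu>: "(\<integral>x. f x \<partial>\<mu>) = (\<integral>x. f x * h x \<partial>\<pi>)" if "f \<in> borel_measurable \<pi>" for f :: "'a \<Rightarrow> real"
    unfolding \<mu>_def using that h(1) h_nonneg by (simp add: integral_density mult.commute)
  have h_mean: "(\<integral>x. h x \<partial>\<pi>) = 1"
    using integral_\<mu>[of "\<lambda>_. 1"] by (simp add: \<mu>.prob_space)
  obtain R where R: "\<And>x. x \<in> M \<Longrightarrow> norm x \<le> R"
    using compact_imp_bounded[OF M] unfolding bounded_iff by blast
  define L where "L = 2 * \<bar>R\<bar>"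
  have L: "norm (x - y) \<le> L" if "x \<in> M" "y \<in> M" for x y
    using R[OF that(1)] R[OF that(2)] norm_triangle_ineq4[of x y] by (simp add: L_def)
  define bound where "bound d = C * H / (b * (1 - d)) + 3 * d + 2 * d * L + d\<^sup>2" for d
  have bound: "transport_cost2 \<mu> \<pi> \<le> ennreal (bound d)" if d: "0 < d" "d < 1" for d
  proof -
    obtain J :: "nat set" and A y where J: "finite J" "J \<noteq> {}" and disj: "disjoint_family_on A J"
      and A: "\<And>j. j \<in> J \<Longrightarrow> A j \<in> sets \<pi>" and y: "\<And>j. j \<in> J \<Longrightarrow> y j \<in> M"
      and A_pos: "\<And>j. j \<in> J \<Longrightarrow> 0 < prob (A j)"
      and near: "\<And>j x. j \<in> J \<Longrightarrow> x \<in> A j \<Longrightarrow> norm (x - y j) \<le> d"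
      and cover: "AE x in \<pi>. x \<in> (\<Union>j\<in>J. A j)"
      using obtain_small_cells[OF d(1)] by metis
    have A_sub: "A j \<subseteq> M" if "j \<in> J" for j
      using sets.sets_into_space[OF A[OF that]] by (simp add: space_eq)
    have "prob (\<Union>j\<in>J. A j) = 1"
      using cover A J(1) by (subst prob_eq_1) auto
    then have sum_A: "(\<Sum>j\<in>J. prob (A j)) = 1"
      using finite_measure_finite_Union[OF J(1) _ disj] A by (simp add: image_subset_iff)
    define e where "e = d / real (card J)"
    have cardJ: "0 < card J" using J by (simp add: card_gt_0_iff)
    have e: "0 < e" using d cardJ by (simp add: e_def)
    obtain \<phi> where \<phi>: "\<And>j. j \<in> J \<Longrightarrow> (\<integral>x. hopf_lax_weight e J y \<phi> 1 x j \<partial>\<mu>) = prob (A j)"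
      using \<mu>.entropic_optimality[OF J e A_pos sum_A, of y] by blast
    let ?S = "hopf_lax e J y \<phi>" and ?w = "hopf_lax_weight e J y \<phi> 1"
    have int_S: "integrable \<pi> (?S t)" for t
      by (intro integrable_continuous continuous_on_hopf_lax J e)
    have "(\<integral>x. ?S d x \<partial>\<pi>) \<le> (\<integral>x. (\<Sum>j\<in>J. \<phi> j * indicator (A j) x) + d / 2 \<partial>\<pi>)"
    proof (rule integral_mono_AE[OF int_S])
      show "integrable \<pi> (\<lambda>x. (\<Sum>j\<in>J. \<phi> j * indicator (A j) x) + d / 2)"
        using A by (intro Bochner_Integration.integrable_add Bochner_Integration.integrable_sum
            integrable_mult_right integrable_real_indicator) (auto simp: emeasure_eq_measure)
      show "AE x in \<pi>. ?S d x \<le> (\<Sum>j\<in>J. \<phi> j * indicator (A j) x) + d / 2"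
        using cover
      proof eventually_elim
        fix x assume "x \<in> (\<Union>j\<in>J. A j)"
        then obtain i where i: "i \<in> J" "x \<in> A i" by blast
        have "(\<Sum>j\<in>J. \<phi> j * indicator (A j) x) = (\<Sum>j\<in>J. if j = i then \<phi> j else 0)"
          using i disj by (intro sum.cong refl) (auto simp: disjoint_family_on_def indicator_def)
        also have "\<dots> = \<phi> i" using i J by simp
        finally have sum_eq: "(\<Sum>j\<in>J. \<phi> j * indicator (A j) x) = \<phi> i" .
        have "(norm (x - y i))\<^sup>2 / (2 * d) \<le> d\<^sup>2 / (2 * d)"
          using near[OF i] d by (intro divide_right_mono power_mono) auto
        also have "\<dots> = d / 2" by (simp add: power2_eq_square)
        finally show "?S d x \<le> (\<Sum>j\<in>J. \<phi> j * indicator (A j) x) + d / 2"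
          using hopf_lax_le[OF J e i(1), of y \<phi> d x] by (simp add: sum_eq)
      qed
    qed
    also have "\<dots> = (\<Sum>j\<in>J. prob (A j) * \<phi> j) + d / 2"
      using A by (subst Bochner_Integration.integral_add)
        (auto simp: Bochner_Integration.integral_sum prob_space emeasure_eq_measure
          mult.commute intro!: Bochner_Integration.integrable_sum)
    finally have start: "(\<integral>x. ?S d x \<partial>\<pi>) \<le> (\<Sum>j\<in>J. prob (A j) * \<phi> j) + d / 2" .
    have "(\<integral>x. ?S 1 x \<partial>\<mu>) = (\<integral>x. ?S 1 x * h x \<partial>\<pi>)"
      using int_S by (intro integral_\<mu>) auto
    also have "\<dots> \<le> (\<integral>x. ?S d x \<partial>\<pi>) + C * H / (2 * b * (1 - d))"
      unfolding H_def by (intro hopf_lax_integral_increase h h_mean b J e d)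
    finally have dual: "(\<integral>x. ?S 1 x \<partial>\<mu>) - (\<Sum>j\<in>J. prob (A j) * \<phi> j) \<le>
        d / 2 + C * H / (2 * b * (1 - d))"
      using start by linarith
    have int_w: "integrable \<mu> (\<lambda>x. ?w x j)" for j
      by (intro \<mu>.integrable_continuous continuous_on_hopf_lax_weight J e)
    have "continuous_on UNIV (\<lambda>x::'a. (norm (x - y j))\<^sup>2)" for j
      by (intro continuous_intros)
    then have int_cost: "integrable \<mu> (\<lambda>x. \<Sum>j\<in>J. ?w x j * (norm (x - y j))\<^sup>2)"
      by (intro \<mu>.integrable_continuous continuous_on_sum continuous_on_mult
          continuous_on_hopf_lax_weight J e)
    have w_sum: "(\<Sum>j\<in>J. ?w x j * ((norm (x - y j))\<^sup>2 + (2 * d * L + d\<^sup>2))) =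
        (\<Sum>j\<in>J. ?w x j * (norm (x - y j))\<^sup>2) + (2 * d * L + d\<^sup>2)" for x
      by (simp add: distrib_left[of "?w x _"] sum.distrib sum_hopf_lax_weight[OF J e]
          flip: sum_distrib_right)
    have "transport_cost2 \<mu> \<pi> \<le>
        (\<integral>\<^sup>+x. ennreal (\<Sum>j\<in>J. ?w x j * ((norm (x - y j))\<^sup>2 + (2 * d * L + d\<^sup>2))) \<partial>\<mu>)"
    proof (rule transport_cost2_le_semidiscrete[where A = A and w = "\<lambda>j x. ?w x j"
          and c = "\<lambda>j x. (norm (x - y j))\<^sup>2 + (2 * d * L + d\<^sup>2)"])
      show "prob_space \<mu>" "prob_space \<pi>" by unfold_locales
      show "(\<lambda>z. (norm (fst z - snd z))\<^sup>2) \<in> borel_measurable (\<mu> \<Otimes>\<^sub>M \<pi>)"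
      proof -
        have [measurable]: "(\<lambda>x. x) \<in> borel_measurable \<mu>" "(\<lambda>x. x) \<in> borel_measurable \<pi>"
          by (intro \<mu>.borel_measurable_continuous borel_measurable_continuous continuous_on_id)+
        have "fst \<in> borel_measurable (\<mu> \<Otimes>\<^sub>M \<pi>)" "snd \<in> borel_measurable (\<mu> \<Otimes>\<^sub>M \<pi>)"
          using measurable_compose[OF measurable_fst[of \<mu> \<pi>], of "\<lambda>x. x" borel]
            measurable_compose[OF measurable_snd[of \<mu> \<pi>], of "\<lambda>x. x" borel] by simp_all
        then show ?thesis by simp
      qed
      \<comment> \<open>Replacing the centre \<open>y j\<close> by a point \<open>x\'\<close> of its cell moves it by at most \<open>d\<close>.\<close>
      show "(norm (x - x'))\<^sup>2 \<le> (norm (x - y j))\<^sup>2 + (2 * d * L + d\<^sup>2)"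
        if "j \<in> J" "x \<in> space \<mu>" "x' \<in> A j" for j x x'
      proof -
        have "norm (x - x') \<le> norm (x - y j) + norm (x' - y j)"
          using norm_triangle_ineq4[of "x - y j" "x' - y j"] by simp
        then have "norm (x - x') \<le> norm (x - y j) + d"
          using near[OF that(1,3)] by linarith
        then have "(norm (x - x'))\<^sup>2 \<le> (norm (x - y j) + d)\<^sup>2"
          by (intro power_mono) auto
        also have "\<dots> = (norm (x - y j))\<^sup>2 + (2 * d * norm (x - y j) + d\<^sup>2)"
          by (simp add: power2_sum mult_ac)
        also have "\<dots> \<le> (norm (x - y j))\<^sup>2 + (2 * d * L + d\<^sup>2)"
          using d L[of x "y j"] y[OF that(1)] that(2) by (simp add: \<mu>.space_eq)
        finally show ?thesis .
      qed
      show "0 \<le> (norm (x - y j))\<^sup>2 + (2 * d * L + d\<^sup>2)" for j x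
        using d by (simp add: L_def)
      show "0 \<le> ?w x j" for j x
        by (rule less_imp_le[OF hopf_lax_weight_pos[OF J e]])
      show "(\<Sum>j\<in>J. ?w x j) = 1" for x
        by (rule sum_hopf_lax_weight[OF J e])
      show "integrable \<mu> (\<lambda>x. ?w x j)" "(\<lambda>x. ?w x j) \<in> borel_measurable \<mu>" for j
        using int_w[of j] by auto
    qed (rule J A disj cover A_pos \<phi>; assumption)+
    also have "\<dots> = ennreal (\<integral>x. (\<Sum>j\<in>J. ?w x j * (norm (x - y j))\<^sup>2) + (2 * d * L + d\<^sup>2) \<partial>\<mu>)"
      unfolding w_sum using int_cost d
      by (intro nn_integral_eq_integral)
        (auto simp: L_def intro!: AE_I2 add_nonneg_nonneg sum_nonneg mult_nonneg_nonneg
          less_imp_le[OF hopf_lax_weight_pos[OF J e]])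
    also have "\<dots> \<le> ennreal (bound d)"
    proof (rule ennreal_leI)
      have "(\<integral>x. (\<Sum>j\<in>J. ?w x j * (norm (x - y j))\<^sup>2) + (2 * d * L + d\<^sup>2) \<partial>\<mu>) =
          (\<integral>x. (\<Sum>j\<in>J. ?w x j * (norm (x - y j))\<^sup>2) \<partial>\<mu>) + (2 * d * L + d\<^sup>2)"
        using int_cost by (simp add: \<mu>.prob_space)
      also have "\<dots> \<le> 2 * ((\<integral>x. ?S 1 x \<partial>\<mu>) - (\<Sum>j\<in>J. prob (A j) * \<phi> j) + e * real (card J))
          + (2 * d * L + d\<^sup>2)"
        by (intro add_right_mono \<mu>.hopf_lax_weighted_cost J e \<phi>)
      also have "\<dots> \<le> 2 * (d / 2 + C * H / (2 * b * (1 - d)) + d) + (2 * d * L + d\<^sup>2)"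
      proof -
        have "e * real (card J) = d" using cardJ by (simp add: e_def)
        with dual show ?thesis
          by (intro add_right_mono mult_left_mono add_mono) simp_all
      qed
      also have "\<dots> = bound d"
        using b d by (simp add: bound_def field_simps)
      finally show "(\<integral>x. (\<Sum>j\<in>J. ?w x j * (norm (x - y j))\<^sup>2) + (2 * d * L + d\<^sup>2) \<partial>\<mu>) \<le> bound d" .
    qed
    finally show ?thesis .
  qed
  have "(bound \<longlongrightarrow> C * H / (b * (1 - 0)) + 3 * 0 + 2 * 0 * L + 0\<^sup>2) (at_right 0)"
    unfolding bound_def using b(1) by (intro tendsto_intros) auto
  then have "((\<lambda>d. ennreal (bound d)) \<longlongrightarrow> ennreal (C * H / b)) (at_right 0)"
    by (intro tendsto_ennrealI) simp
  moreover have "\<forall>\<^sub>F d in at_right 0. transport_cost2 \<mu> \<pi> \<le> ennreal (bound d)"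
    using eventually_at_right_less[of 0] eventually_at_right_real[of 0 1]
    by (auto elim!: eventually_mono intro: bound)
  ultimately show ?thesis
    unfolding \<mu>_def[symmetric] H_def[symmetric]
    by (intro tendsto_lowerbound) auto
qed

section \<open>Tangent spaces and the Riemannian gradient\<close>

lemma C1_curve_in_param_line:
  assumes \<psi>: "local_param M V \<psi>" and u: "u \<in> V"
  shows "C1_curve_in M (\<psi> u) (\<lambda>t. \<psi> (u + t *\<^sub>R a)) (frechet_derivative \<psi> (at u) a)"
proof -
  let ?D = "\<lambda>x. frechet_derivative \<psi> (at x)"
  have "openin (top_of_set M) (\<psi> ` V)"
    using \<psi> by (simp add: local_param_def)
  then have sub: "\<psi> ` V \<subseteq> M" by (rule openin_imp_subset)
  have V: "open V" and \<psi>_diff: "\<And>x. x \<in> V \<Longrightarrow> \<psi> differentiable (at x)"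
    and D_diff: "\<And>x. x \<in> V \<Longrightarrow> (\<lambda>x. ?D x a) differentiable (at x)"
    using \<psi> by (auto simp: local_param_def numeral_2_eq_2)
  have D: "(\<psi> has_derivative ?D x) (at x)" if "x \<in> V" for x
    using \<psi>_diff[OF that] by (simp add: frechet_derivative_works)
  have D_cont: "continuous_on V (\<lambda>x. ?D x a)"
    using D_diff by (intro continuous_at_imp_continuous_on ballI differentiable_imp_continuous_within)
  obtain \<epsilon> where \<epsilon>: "0 < \<epsilon>" "ball u \<epsilon> \<subseteq> V"
    using V u openE by blast
  define \<delta> where "\<delta> = \<epsilon> / (norm a + 1)"
  have na: "0 < norm a + 1" by (rule add_nonneg_pos) auto
  have \<delta>: "0 < \<delta>" using \<epsilon> na by (simp add: \<delta>_def)
  have in_V: "u + t *\<^sub>R a \<in> V" if "t \<in> {- \<delta><..<\<delta>}" for t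
  proof -
    have "norm (t *\<^sub>R a) \<le> \<bar>t\<bar> * (norm a + 1)" by (simp add: distrib_left)
    also have "\<dots> < \<delta> * (norm a + 1)"
      using that na by (intro mult_strict_right_mono) auto
    also have "\<dots> = \<epsilon>" using na by (simp add: \<delta>_def)
    finally have "u + t *\<^sub>R a \<in> ball u \<epsilon>" by (simp add: dist_norm)
    with \<epsilon> show ?thesis by blast
  qed
  have \<gamma>: "((\<lambda>t. \<psi> (u + t *\<^sub>R a)) has_derivative (\<lambda>s. s *\<^sub>R ?D (u + t *\<^sub>R a) a)) (at t)"
    if "t \<in> {- \<delta><..<\<delta>}" for t
  proof -
    have "((\<lambda>t. u + t *\<^sub>R a) has_derivative (\<lambda>s. s *\<^sub>R a)) (at t)"
      by (auto intro!: derivative_eq_intros)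
    from has_derivative_compose[OF this D[OF in_V[OF that]]]
    show ?thesis
      using linear_frechet_derivative[OF \<psi>_diff[OF in_V[OF that]]] by (simp add: linear_cmul)
  qed
  have fd: "frechet_derivative (\<lambda>t. \<psi> (u + t *\<^sub>R a)) (at t) = (\<lambda>s. s *\<^sub>R ?D (u + t *\<^sub>R a) a)"
    if "t \<in> {- \<delta><..<\<delta>}" for t
    using frechet_derivative_at[OF \<gamma>[OF that]] by simp
  have cont: "continuous_on {- \<delta><..<\<delta>} (\<lambda>t. s *\<^sub>R ?D (u + t *\<^sub>R a) a)" for s :: real
    using in_V
    by (intro continuous_on_scaleR continuous_on_const continuous_on_compose2[OF D_cont]
        continuous_intros) auto
  have "continuous_on {- \<delta><..<\<delta>} (\<lambda>t. frechet_derivative (\<lambda>t. \<psi> (u + t *\<^sub>R a)) (at t) s)" for s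
    using continuous_on_cong[OF refl, of "{- \<delta><..<\<delta>}"
        "\<lambda>t. frechet_derivative (\<lambda>t. \<psi> (u + t *\<^sub>R a)) (at t) s" "\<lambda>t. s *\<^sub>R ?D (u + t *\<^sub>R a) a"]
      cont[of s] fd by simp
  then have "Ck_on 1 (\<lambda>t. \<psi> (u + t *\<^sub>R a)) {- \<delta><..<\<delta>}"
    unfolding One_nat_def Ck_on.simps using \<gamma> differentiableI by blast
  moreover have "(\<lambda>t. \<psi> (u + t *\<^sub>R a)) ` {- \<delta><..<\<delta>} \<subseteq> M"
    using in_V sub by blast
  ultimately show ?thesis
    unfolding C1_curve_in_def has_vector_derivative_def
    using \<gamma>[of 0] \<delta> by auto
qed

text \<open>
  A curve in \<open>M\<close> lifts through the chart, but a priori the lift is only continuous. What replaces its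
  derivative is that \<open>\<psi>\<close> is bounded below to first order: the increment of the lift is at most a constant
  times that of the curve, so the error of the linearization of \<open>\<psi>\<close> is \<open>o(t)\<close> along the curve. Hence every
  vector orthogonal to the range of the derivative of \<open>\<psi>\<close> is orthogonal to the velocity \<open>v\<close>.
\<close>

lemma C1_curve_in_derivative_in_range:
  fixes \<psi> :: "real^'d \<Rightarrow> real^'n"
  assumes \<psi>: "local_param M V \<psi>" and u: "u \<in> V" and \<gamma>: "C1_curve_in M (\<psi> u) \<gamma> v"
  shows "v \<in> range (frechet_derivative \<psi> (at u))"
proof -
  let ?p = "\<psi> u"
  define D where "D = frechet_derivative \<psi> (at u)"
  obtain \<psi>' where V: "open V" "openin (top_of_set M) (\<psi> ` V)" and "homeomorphism V (\<psi> ` V) \<psi> \<psi>'"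
    and \<psi>_diff: "\<psi> differentiable (at u)" and inj: "inj D"
    using \<psi> u by (auto simp: local_param_def numeral_2_eq_2 D_def)
  then have \<psi>': "continuous_on (\<psi> ` V) \<psi>'" "\<And>x. x \<in> V \<Longrightarrow> \<psi>' (\<psi> x) = x"
    by (auto simp: homeomorphism_def)
  have D: "(\<psi> has_derivative D) (at u)"
    using \<psi>_diff unfolding D_def by (simp add: frechet_derivative_works)
  then have lin: "linear D" by (rule has_derivative_linear)
  obtain O' where O': "open O'" "\<psi> ` V = M \<inter> O'"
    using V(2) by (auto simp: openin_open)
  obtain B where B: "0 < B" "\<And>x. B * norm x \<le> norm (D x)"
    using linear_inj_bounded_below_pos[OF lin inj] by blast
  obtain \<epsilon> where \<epsilon>: "0 < \<epsilon>" "\<gamma> ` {- \<epsilon><..<\<epsilon>} \<subseteq> M"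
    and \<gamma>0: "\<gamma> 0 = ?p" and \<gamma>v: "(\<gamma> has_vector_derivative v) (at 0)"
    using \<gamma> by (auto simp: C1_curve_in_def)
  have \<gamma>_tendsto: "(\<gamma> \<longlongrightarrow> ?p) (at 0)"
    using has_vector_derivative_continuous[OF \<gamma>v] by (simp add: isCont_def \<gamma>0)
  have quot: "((\<lambda>t. (\<gamma> t - ?p) /\<^sub>R t) \<longlongrightarrow> v) (at 0)"
  proof (rule LIM_zero_cancel, rule tendsto_norm_zero_cancel)
    have "((\<lambda>t. norm (\<gamma> t - ?p - t *\<^sub>R v) / norm t) \<longlongrightarrow> 0) (at 0)"
      using \<gamma>v by (simp add: has_vector_derivative_def has_derivative_iff_norm \<gamma>0)
    moreover have "norm (\<gamma> t - ?p - t *\<^sub>R v) / norm t = norm ((\<gamma> t - ?p) /\<^sub>R t - v)" if "t \<noteq> 0" for t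
    proof -
      have "(\<gamma> t - ?p) /\<^sub>R t - v = (\<gamma> t - ?p - t *\<^sub>R v) /\<^sub>R t"
        using that by (simp add: scaleR_diff_right)
      then show ?thesis by (simp add: divide_inverse mult.commute)
    qed
    then have "\<forall>\<^sub>F t in at 0. norm (\<gamma> t - ?p - t *\<^sub>R v) / norm t = norm ((\<gamma> t - ?p) /\<^sub>R t - v)"
      by (simp add: eventually_at_filter)
    ultimately show "((\<lambda>t. norm ((\<gamma> t - ?p) /\<^sub>R t - v)) \<longlongrightarrow> 0) (at 0)"
      by (rule Lim_transform_eventually)
  qed
  have p: "?p \<in> O'" using u O' by blast
  have "\<forall>\<^sub>F t in at 0. t \<in> {- \<epsilon><..<\<epsilon>}"
    using \<epsilon> by (intro eventually_at_in_open') auto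
  moreover have "\<forall>\<^sub>F t in at 0. \<gamma> t \<in> O'"
    using topological_tendstoD[OF \<gamma>_tendsto O'(1) p] .
  ultimately have in_chart: "\<forall>\<^sub>F t in at 0. \<gamma> t \<in> \<psi> ` V"
    by eventually_elim (use \<epsilon> O' in blast)
  have "((\<lambda>t. \<psi>' (\<gamma> t)) \<longlongrightarrow> \<psi>' ?p) (at 0)"
    using \<psi>'(1) u in_chart \<gamma>_tendsto
    by (intro continuous_on_tendsto_compose[of "\<psi> ` V" \<psi>']) auto
  then have U: "((\<lambda>t. \<psi>' (\<gamma> t)) \<longlongrightarrow> u) (at 0)"
    by (simp add: \<psi>'(2) u)
  have orth: "z \<bullet> v = 0" if z: "\<And>x. z \<bullet> D x = 0" for z
  proof -
    have "\<bar>z \<bullet> v\<bar> \<le> 0 + e" if e: "0 < e" for e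
    proof -
      \<comment> \<open>Here \<open>B / 2\<close> absorbs the linearization error in the lower bound for \<open>D\<close>; the other term makes the final estimate \<open>e\<close>.\<close>
      define c where "c = min (B / 2) (e * B / (2 * (norm z * norm v + 1)))"
      have nz: "0 < norm z * norm v + 1" by (intro add_nonneg_pos mult_nonneg_nonneg) auto
      have c: "0 < c" using B e nz by (simp add: c_def)
      have c_le: "c \<le> B / 2" unfolding c_def by (rule min.cobounded1)
      obtain \<delta> where \<delta>: "0 < \<delta>"
        and appr: "\<And>x. norm (x - u) < \<delta> \<Longrightarrow> norm (\<psi> x - \<psi> u - D (x - u)) \<le> c * norm (x - u)"
        using D c unfolding has_derivative_at_alt by blast
      have "\<forall>\<^sub>F t in at 0. \<bar>z \<bullet> ((\<gamma> t - ?p) /\<^sub>R t)\<bar> \<le> norm z * (c * (2 / B)) * norm ((\<gamma> t - ?p) /\<^sub>R t)"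
        using in_chart tendstoD[OF U \<delta>]
      proof eventually_elim
        fix t assume "\<gamma> t \<in> \<psi> ` V" and near: "dist (\<psi>' (\<gamma> t)) u < \<delta>"
        then obtain x where x: "x \<in> V" "\<gamma> t = \<psi> x" by blast
        with near have "norm (x - u) < \<delta>" by (simp add: \<psi>'(2) dist_norm)
        note a = appr[OF this]
        have "B * norm (x - u) \<le> norm (D (x - u))" by (rule B(2))
        also have "\<dots> \<le> norm (\<psi> x - \<psi> u) + norm (\<psi> x - \<psi> u - D (x - u))"
          using norm_triangle_ineq4[of "\<psi> x - \<psi> u" "\<psi> x - \<psi> u - D (x - u)"] by simp
        also have "norm (\<psi> x - \<psi> u - D (x - u)) \<le> B / 2 * norm (x - u)"
          using c_le by (intro order.trans[OF a] mult_right_mono) auto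
        finally have "norm (x - u) \<le> 2 / B * norm (\<psi> x - \<psi> u)"
          using B(1) by (simp add: field_simps)
        then have b: "norm (\<psi> x - \<psi> u - D (x - u)) \<le> c * (2 / B * norm (\<psi> x - \<psi> u))"
          using c by (intro order.trans[OF a] mult_left_mono) auto
        have "\<bar>z \<bullet> (\<psi> x - \<psi> u)\<bar> = \<bar>z \<bullet> (\<psi> x - \<psi> u - D (x - u))\<bar>"
          by (simp add: inner_diff_right z)
        also have "\<dots> \<le> norm z * norm (\<psi> x - \<psi> u - D (x - u))"
          by (rule Cauchy_Schwarz_ineq2)
        also have "\<dots> \<le> norm z * (c * (2 / B * norm (\<psi> x - \<psi> u)))"
          using b by (intro mult_left_mono) auto
        finally have "\<bar>inverse t\<bar> * \<bar>z \<bullet> (\<psi> x - \<psi> u)\<bar> \<le>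
            \<bar>inverse t\<bar> * (norm z * (c * (2 / B * norm (\<psi> x - \<psi> u))))"
          by (intro mult_left_mono) auto
        then show "\<bar>z \<bullet> ((\<gamma> t - ?p) /\<^sub>R t)\<bar> \<le> norm z * (c * (2 / B)) * norm ((\<gamma> t - ?p) /\<^sub>R t)"
          by (simp add: x abs_mult mult_ac)
      qed
      then have "\<bar>z \<bullet> v\<bar> \<le> norm z * (c * (2 / B)) * norm v"
        by (intro tendsto_le[OF _ tendsto_mult[OF tendsto_const tendsto_norm[OF quot]]
              tendsto_rabs[OF tendsto_inner[OF tendsto_const quot]]]) auto
      also have "\<dots> = c * (2 / B * (norm z * norm v))" by (simp add: mult_ac)
      also have "\<dots> \<le> e * B / (2 * (norm z * norm v + 1)) * (2 / B * (norm z * norm v))"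
        using B by (intro mult_right_mono) (auto simp: c_def)
      also have "\<dots> = e * ((norm z * norm v) / (norm z * norm v + 1))"
      proof -
        have "e * B / (2 * k) * (2 / B * n) = e * (n / k)" for k n
          using B(1) by simp
        then show ?thesis .
      qed
      also have "\<dots> \<le> e * 1"
        using e nz by (intro mult_left_mono) auto
      finally show ?thesis by simp
    qed
    then have "\<bar>z \<bullet> v\<bar> \<le> 0" by (rule field_le_epsilon)
    then show ?thesis by simp
  qed
  obtain w z where wz: "w \<in> span (range D)" "\<And>x. x \<in> span (range D) \<Longrightarrow> orthogonal z x" "v = w + z"
    using orthogonal_subspace_decomp_exists[of "range D" v] by blast
  have span: "span (range D) = range D"
    by (simp add: span_eq_iff linear_subspace_image lin)
  have "z \<bullet> v = 0"
    using wz(2) by (intro orth) (simp add: span orthogonal_def)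
  moreover have "z \<bullet> w = 0" using wz(1,2) by (simp add: orthogonal_def)
  ultimately have "z = 0" using wz(3) by (simp add: inner_add_right)
  with wz(1,3) have "v \<in> range D" unfolding span by simp
  then show ?thesis by (simp only: D_def)
qed

lemma tangent_space_eq_range:
  fixes \<psi> :: "real^'d \<Rightarrow> real^'n"
  assumes "local_param M V \<psi>" "u \<in> V"
  shows "tangent_space M (\<psi> u) = range (frechet_derivative \<psi> (at u))"
  using C1_curve_in_derivative_in_range[OF assms] C1_curve_in_param_line[OF assms]
  unfolding tangent_space_def by blast

lemma subspace_tangent_space:
  fixes M :: "(real^'n) set"
  assumes "C2_submanifold TYPE('d::finite) M" "p \<in> M"
  shows "subspace (tangent_space M p)"
proof -
  obtain V and \<psi> :: "real^'d \<Rightarrow> real^'n" and u where \<psi>: "local_param M V \<psi>" "u \<in> V" "p = \<psi> u"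
    using assms unfolding C2_submanifold_def by blast
  then have "linear (frechet_derivative \<psi> (at u))"
    by (intro linear_frechet_derivative) (auto simp: local_param_def numeral_2_eq_2)
  then show ?thesis
    unfolding \<psi>(3) tangent_space_eq_range[OF \<psi>(1,2)]
    by (intro linear_subspace_image subspace_UNIV)
qed

text \<open>
  The unique vector in the definition of the Riemannian gradient is the orthogonal projection of \<open>G\<close> to the
  tangent space. Uniqueness uses that the tangent space is a subspace, and projection shortens.
\<close>

lemma norm_riemannian_gradient_le:
  fixes f :: "real^'n \<Rightarrow> real"
  assumes M: "C2_submanifold TYPE('d::finite) M" "p \<in> M"
    and f: "(f has_derivative (\<lambda>v. G \<bullet> v)) (at p)"
  shows "norm (riemannian_gradient M f p) \<le> norm G"
proof -
  let ?T = "tangent_space M p"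
  have T: "subspace ?T" by (rule subspace_tangent_space[OF M])
  then have span: "span ?T = ?T" by (simp add: span_eq_iff)
  have chain: "((\<lambda>t. f (\<gamma> t)) has_real_derivative G \<bullet> v) (at 0)" if "C1_curve_in M p \<gamma> v" for \<gamma> v
  proof -
    have "\<gamma> 0 = p" "(\<gamma> has_derivative (\<lambda>t. t *\<^sub>R v)) (at 0)"
      using that by (auto simp: C1_curve_in_def has_vector_derivative_def)
    then have "((\<lambda>t. f (\<gamma> t)) has_derivative (\<lambda>t. G \<bullet> (t *\<^sub>R v))) (at 0)"
      using f by (intro has_derivative_compose[of \<gamma> _ 0 UNIV f]) auto
    then show ?thesis
      by (simp add: has_field_derivative_def mult.commute[of _ "G \<bullet> v"])
  qed
  obtain w z where wz: "w \<in> ?T" "\<And>x. x \<in> ?T \<Longrightarrow> z \<bullet> x = 0" "G = w + z"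
    using orthogonal_subspace_decomp_exists[of ?T G] unfolding span orthogonal_def by blast
  have w: "w \<bullet> v = G \<bullet> v" if "v \<in> ?T" for v
    using wz that by (simp add: inner_add_left)
  have "riemannian_gradient M f p = w"
    unfolding riemannian_gradient_def
  proof (rule the_equality)
    show "w \<in> ?T \<and> (\<forall>\<gamma> v. C1_curve_in M p \<gamma> v \<longrightarrow>
        ((\<lambda>t. f (\<gamma> t)) has_real_derivative w \<bullet> v) (at 0))"
    proof (intro conjI wz(1) allI impI)
      fix \<gamma> v assume \<gamma>: "C1_curve_in M p \<gamma> v"
      then have "v \<in> ?T" by (auto simp: tangent_space_def)
      with chain[OF \<gamma>] w show "((\<lambda>t. f (\<gamma> t)) has_real_derivative w \<bullet> v) (at 0)" by simp
    qed
  next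
    fix w' assume w': "w' \<in> ?T \<and> (\<forall>\<gamma> v. C1_curve_in M p \<gamma> v \<longrightarrow>
        ((\<lambda>t. f (\<gamma> t)) has_real_derivative w' \<bullet> v) (at 0))"
    have "w' \<bullet> v = w \<bullet> v" if v: "v \<in> ?T" for v
    proof -
      obtain \<gamma> where "C1_curve_in M p \<gamma> v" using v by (auto simp: tangent_space_def)
      with chain w' have "G \<bullet> v = w' \<bullet> v" using DERIV_unique by blast
      with w[OF v] show ?thesis by simp
    qed
    moreover have "w' - w \<in> ?T" using T w' wz(1) by (simp add: subspace_diff)
    ultimately have "(w' - w) \<bullet> (w' - w) = 0" by (simp add: inner_diff_left)
    then show "w' = w" by simp
  qed
  moreover have "norm w * norm w \<le> norm G * norm w"
    using w[OF wz(1)] norm_cauchy_schwarz[of G w] by (simp add: power2_eq_square flip: power2_norm_eq_inner)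
  then have "norm w \<le> norm G"
    by (cases "w = 0") auto
  ultimately show ?thesis by simp
qed

section \<open>The bound on the Wasserstein distance\<close>

text \<open>
  Passing to a larger constant \<open>C\'\<close> makes the constant positive even when \<open>C\<close> is not. The two gradient
  integrals are compared without knowing whether the squared norm of the Riemannian gradient is integrable: if it is not,
  its Bochner integral is 0, which the right-hand side dominates.
\<close>

lemma poincare_space_of_poincare_constant:
  fixes M :: "(real^'n) set"
  assumes M: "compact M" and manifold: "C2_submanifold TYPE('d::finite) M"
    and \<pi>: "prob_space \<pi>" "sets \<pi> = sets (restrict_space borel M)"
    and PI: "poincare_constant M \<pi> C" and C: "C \<le> C'" "0 < C'"
  shows "poincare_space \<pi> M C'"
proof -
  interpret compact_prob_space \<pi> M
    using M \<pi> by (simp add: compact_prob_space_def compact_prob_space_axioms_def)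
  show ?thesis
  proof
    fix f :: "real^'n \<Rightarrow> real" and G
    assume f: "elementary_smooth f" and G: "\<And>x. (f has_derivative (\<lambda>v. G x \<bullet> v)) (at x)"
      and int_G: "integrable \<pi> (\<lambda>x. (norm (G x))\<^sup>2)"
    have "smooth_on_submanifold M f"
      unfolding smooth_on_submanifold_def using elementary_smooth_imp_Ck_on[OF f] open_UNIV by blast
    with PI have "(\<integral>x. (f x - (\<integral>x. f x \<partial>\<pi>))\<^sup>2 \<partial>\<pi>) \<le>
        C * (\<integral>x. (norm (riemannian_gradient M f x))\<^sup>2 \<partial>\<pi>)"
      by (simp add: poincare_constant_def)
    also have "\<dots> \<le> C' * (\<integral>x. (norm (riemannian_gradient M f x))\<^sup>2 \<partial>\<pi>)"
      using C by (intro mult_right_mono) auto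
    also have "\<dots> \<le> C' * (\<integral>x. (norm (G x))\<^sup>2 \<partial>\<pi>)"
    proof (intro mult_left_mono integral_mono' int_G)
      fix x assume "x \<in> space \<pi>"
      then show "(norm (riemannian_gradient M f x))\<^sup>2 \<le> (norm (G x))\<^sup>2"
        using norm_riemannian_gradient_le[OF manifold _ G] by (intro power_mono) (auto simp: space_eq)
    qed (use C in auto)
    finally show "(\<integral>x. (f x - (\<integral>x. f x \<partial>\<pi>))\<^sup>2 \<partial>\<pi>) \<le> C' * (\<integral>x. (norm (G x))\<^sup>2 \<partial>\<pi>)" .
  qed (rule C(2))
qed

text \<open>
  If the normalizing integral were 0 or did not exist, division by zero would turn the density into 0. So for a nonzero
  Gibbs measure the normalizing integral exists and is positive.
\<close>

lemma prob_space_gibbs_measure: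
  assumes "gibbs_measure vol g \<noteq> null_measure vol"
  shows "prob_space (gibbs_measure vol g)"
proof -
  define Z where "Z = (\<integral>y. exp (- g y) \<partial>vol)"
  have eq: "gibbs_measure vol g = density vol (\<lambda>y. ennreal (exp (- g y) / Z))"
    by (simp add: gibbs_measure_def Z_def)
  have "Z \<noteq> 0"
  proof
    assume "Z = 0"
    then have "gibbs_measure vol g = null_measure vol"
      unfolding eq by (intro measure_eqI) (auto simp: emeasure_density)
    with assms show False by contradiction
  qed
  then have int: "integrable vol (\<lambda>y. exp (- g y))"
    using not_integrable_integral_eq unfolding Z_def by blast
  have "0 \<le> Z" unfolding Z_def by (intro Bochner_Integration.integral_nonneg) simp
  with \<open>Z \<noteq> 0\<close> have Z: "0 < Z" by simp
  show ?thesis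
  proof (rule prob_spaceI)
    have "emeasure (gibbs_measure vol g) (space (gibbs_measure vol g)) =
        (\<integral>\<^sup>+y. ennreal (exp (- g y) / Z) \<partial>vol)"
      unfolding eq using int
      by (subst emeasure_density) (auto intro!: nn_integral_cong simp: indicator_def)
    also have "\<dots> = ennreal (\<integral>y. exp (- g y) / Z \<partial>vol)"
      using int Z by (intro nn_integral_eq_integral) auto
    also have "\<dots> = 1"
      using Z by (simp flip: Z_def)
    finally show "emeasure (gibbs_measure vol g) (space (gibbs_measure vol g)) = 1" .
  qed
qed

lemma W2_le:
  assumes "transport_cost2 \<mu> \<nu> \<le> ennreal c" "0 \<le> c"
  shows "W2 \<mu> \<nu> \<le> ennreal (sqrt c)"
proof -
  have "transport_cost2 \<mu> \<nu> \<noteq> \<infinity>"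
    using assms(1) by (auto simp: top_unique)
  moreover have "enn2real (transport_cost2 \<mu> \<nu>) \<le> c"
    using assms by (rule enn2real_leI[rotated])
  ultimately show ?thesis
    by (simp add: W2_def ennreal_leI)
qed

theorem lemma3:
  fixes M :: "(real^'n) set"
    and vol \<pi> \<mu> :: "(real^'n) measure"
    and z\<^sub>0 :: "real^'n"
    and \<tau>\<^sub>0 R\<^sub>0 r C b :: real
    and g h :: "real^'n \<Rightarrow> real"
  defines "\<pi> \<equiv> gibbs_measure vol g"
    and "K \<equiv> cball z\<^sub>0 (R\<^sub>0 + 3 * r)"
  assumes dim: "CARD('d::finite) < CARD('n)"
    and M: "compact M" "connected M" "C2_submanifold TYPE('d) M"
    and reach: "0 < \<tau>\<^sub>0" "ereal \<tau>\<^sub>0 \<le> reach M"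
    and vol: "riemannian_volume TYPE('d) M vol"
    and ball: "0 < R\<^sub>0" "M \<subseteq> cball z\<^sub>0 R\<^sub>0"
    and r: "0 < 2 * r" "2 * r < \<tau>\<^sub>0"
    and g: "\<exists>N. open N \<and> K \<subseteq> N \<and> Ck_on 2 g N"
    and g_grad: "bdd_above ((\<lambda>x. norm (gradient g x)) ` K)"
    and g_hess: "bdd_above ((\<lambda>x. onorm (hessian g x)) ` K)"
    and g_osc: "bdd_above (g ` K)" "bdd_below (g ` K)"
    and PI: "poincare_constant M \<pi> C"
    and \<mu>: "prob_space \<mu>" "\<mu> = density \<pi> (\<lambda>x. ennreal (h x))"
    and h_L2: "h \<in> borel_measurable \<pi>" "integrable \<pi> (\<lambda>x. (h x)\<^sup>2)"
    and h_lower: "0 < b" "AE x in \<pi>. b \<le> h x"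
  shows "W2 \<mu> \<pi> \<le> ennreal (sqrt (C / min 1 b) * sqrt (\<integral>x. (h x - 1)\<^sup>2 \<partial>\<pi>))"
proof -
  define H where "H = (\<integral>x. (h x - 1)\<^sup>2 \<partial>\<pi>)"
  define \<beta> where "\<beta> = min 1 b"
  have \<beta>: "0 < \<beta>" "\<beta> \<le> 1" "AE x in \<pi>. \<beta> \<le> h x"
    using h_lower by (auto simp: \<beta>_def elim: eventually_mono)
  have H: "0 \<le> H" unfolding H_def by (intro Bochner_Integration.integral_nonneg) simp
  have "prob_space \<pi>"
    unfolding \<pi>_def
  proof (rule prob_space_gibbs_measure, rule notI)
    assume "gibbs_measure vol g = null_measure vol"
    then have "emeasure \<mu> (space \<mu>) = 0"
      using h_L2(1) by (simp add: \<mu>(2) \<pi>_def emeasure_density)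
    then show False using prob_space.emeasure_space_1[OF \<mu>(1)] by simp
  qed
  moreover have "sets \<pi> = sets (restrict_space borel M)"
    using vol by (simp add: \<pi>_def gibbs_measure_def riemannian_volume_def Let_def)
  ultimately have space: "poincare_space \<pi> M C'" if "C \<le> C'" "0 < C'" for C'
    using poincare_space_of_poincare_constant[OF M(1,3) _ _ PI] that by blast
  \<comment> \<open>The constants \<open>C\'\<close> decrease to \<open>max C 0\<close>; for negative \<open>C\<close> both final bounds are 0.\<close>
  have "transport_cost2 \<mu> \<pi> \<le> ennreal (C' * H / \<beta>)" if "max C 0 < C'" for C'
    using poincare_space.transport_cost2_density_le[OF space h_L2 _ \<beta>, of C'] \<mu> that
    by (simp add: H_def)
  then have "\<forall>\<^sub>F C' in at_right (max C 0). transport_cost2 \<mu> \<pi> \<le> ennreal (C' * H / \<beta>)"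
    by (auto simp: eventually_at_filter)
  moreover have "((\<lambda>C'. ennreal (C' * H / \<beta>)) \<longlongrightarrow> ennreal (max C 0 * H / \<beta>)) (at_right (max C 0))"
    using \<beta>(1) by (intro tendsto_ennrealI tendsto_intros) auto
  ultimately have "transport_cost2 \<mu> \<pi> \<le> ennreal (max C 0 * H / \<beta>)"
    by (intro tendsto_lowerbound) auto
  then have "W2 \<mu> \<pi> \<le> ennreal (sqrt (max C 0 * H / \<beta>))"
    using H \<beta>(1) by (intro W2_le) auto
  also have "ennreal (sqrt (max C 0 * H / \<beta>)) = ennreal (sqrt (C / \<beta>) * sqrt H)"
  proof (cases "0 \<le> C")
    case True
    then show ?thesis by (simp add: max_def real_sqrt_mult real_sqrt_divide)
  next
    case False
    with H \<beta>(1) have "sqrt (C / \<beta>) * sqrt H \<le> 0"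
      by (intro mult_nonpos_nonneg) (auto simp: divide_nonpos_pos)
    with False show ?thesis by (simp add: max_def ennreal_neg)
  qed
  finally show ?thesis
    by (simp add: \<beta>_def H_def)
qed

end
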